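(* Let $G$ be a finitely generated virtually abelian group, let $S$ be any finite generating set of $G$, and let $N$ be a torsion-free abelian normal subgroup of finite index in $G$. Let $\varphi\in\operatorname{End}(G)$ with $\varphi(N)\subset N$. Then, as $r\to\infty$, $$f_R^S(r)=\Theta\left(r^{\,\operatorname{rank}(N)-\min\limits_{gN\in G/N}\operatorname{rank}(\operatorname{Id}_N-\tau_g\circ\varphi|_N)}\right)\quad\text{and}\quad \#B_G^S(r)=\Theta\left(r^{\operatorname{rank}(N)}\right),$$ where $\tau_g:G\to G:h\mapsto ghg^{-1}$ denotes conjugation by $g\in G$.
   Context: For a group $G$ with finite generating set $S$, the word length $|g|_S$ of $g\in G$ is the minimal $k\in\mathbb{N}=\{0,1,2,\dots\}$ such that $g=s_1\cdots s_k$ with $s_i\in S\cup S^{-1}$, and $B_G^S(r)=\{g\in G : |g|_S\le r\}$ for $r\in\mathbb{R}_{\ge 0}$. For $\varphi\in\operatorname{End}(G)$, elements $g,h\in G$ are $\varphi$-twisted conjugate ($g\sim_\varphi h$) if there is $z\in G$ with $g=zh\varphi(z)^{-1}$. This is an equivalence relation; the class of $g$ is denoted $[g]_\varphi$. The twisted conjugacy growth function of $\varphi$ with respect to $S$ is $f_R^S(r)=\#\{[g]_\varphi : g\in B_G^S(r)\}$ for $r\in\mathbb{R}_{\ge 0}$. Here $N\cong\mathbb{Z}^{\operatorname{rank}(N)}$ is written additively in expressions such as $\operatorname{Id}_N-\tau_g\circ\varphi|_N\in\operatorname{End}(N)$, and the rank of an endomorphism of $N$ is the rank of its image. Since $N$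 is abelian, $\operatorname{Id}_N-\tau_g\circ\varphi|_N$ depends only on the coset $gN$. For non-negative functions $f,g$, $f(r)=\Theta(g(r))$ as $r\to\infty$ means that there are $c_1,c_2>0$ and $n_0\in\mathbb{N}_{>0}$ such that $c_1g(r)\le f(r)\le c_2g(r)$ for all $r\ge n_0$. *)

theory Defs
  imports "HOL-Algebra.Algebra" "HOL-Library.Landau_Symbols" Complex_Main
begin

definition finitely_generated :: "('a, 'b) monoid_scheme \<Rightarrow> bool" where
  "finitely_generated G \<longleftrightarrow>
     (\<exists>S. finite S \<and> S \<subseteq> carrier G \<and> generate G S = carrier G)"

definition virtually_abelian :: "('a, 'b) monoid_scheme \<Rightarrow> bool" where
  "virtually_abelian G \<longleftrightarrow>
     (\<exists>H. subgroup H G \<and> comm_group (G\<lparr>carrier := H\<rparr>) \<and> finite (rcosets\<^bsub>G\<^esub> H))"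

definition torsion_free :: "('a, 'b) monoid_scheme \<Rightarrow> bool" where
  "torsion_free G \<longleftrightarrow>
     (\<forall>x\<in>carrier G. \<forall>n::nat. 0 < n \<and> x [^]\<^bsub>G\<^esub> n = \<one>\<^bsub>G\<^esub> \<longrightarrow> x = \<one>\<^bsub>G\<^esub>)"

definition word_length :: "('a, 'b) monoid_scheme \<Rightarrow> 'a set \<Rightarrow> 'a \<Rightarrow> nat" where
  "word_length G S g =
     (LEAST k. \<exists>ws. length ws = k \<and> set ws \<subseteq> S \<union> m_inv G ` S \<and>
                    g = foldr (\<otimes>\<^bsub>G\<^esub>) ws \<one>\<^bsub>G\<^esub>)"

definition word_ball :: "('a, 'b) monoid_scheme \<Rightarrow> 'a set \<Rightarrow> real \<Rightarrow> 'a set" where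
  "word_ball G S r = {g \<in> carrier G. real (word_length G S g) \<le> r}"

definition twisted_conj :: "('a, 'b) monoid_scheme \<Rightarrow> ('a \<Rightarrow> 'a) \<Rightarrow> ('a \<times> 'a) set" where
  "twisted_conj G \<phi> =
     {(g, h). g \<in> carrier G \<and> h \<in> carrier G \<and>
        (\<exists>z\<in>carrier G. g = z \<otimes>\<^bsub>G\<^esub> h \<otimes>\<^bsub>G\<^esub> inv\<^bsub>G\<^esub> (\<phi> z))}"

definition twisted_class :: "('a, 'b) monoid_scheme \<Rightarrow> ('a \<Rightarrow> 'a) \<Rightarrow> 'a \<Rightarrow> 'a set" where
  "twisted_class G \<phi> g = twisted_conj G \<phi> `` {g}"

definition twisted_growth ::
    "('a, 'b) monoid_scheme \<Rightarrow> 'a set \<Rightarrow> ('a \<Rightarrow> 'a) \<Rightarrow> real \<Rightarrow> nat" where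
  "twisted_growth G S \<phi> r = card (twisted_class G \<phi> ` word_ball G S r)"

definition conjugation :: "('a, 'b) monoid_scheme \<Rightarrow> 'a \<Rightarrow> 'a \<Rightarrow> 'a" where
  "conjugation G g h = g \<otimes>\<^bsub>G\<^esub> h \<otimes>\<^bsub>G\<^esub> inv\<^bsub>G\<^esub> g"

text \<open>The rank of a group isomorphic to some \<open>\<int>\<^sup>n\<close> is that \<open>n\<close>. The value is unspecified
  for other groups, but every subgroup of a finitely generated torsion-free abelian group
  is of this form.\<close>

definition free_rank :: "('a, 'b) monoid_scheme \<Rightarrow> nat" where
  "free_rank A = (THE n. A \<cong> free_Abelian_group {..<n})"

lemma free_rank_eqI:
  assumes "group A" and iso: "A \<cong> free_Abelian_group {..<n::nat}"
  shows "free_rank A = n"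
  unfolding free_rank_def
proof (rule the_equality)
  fix m :: nat
  assume "A \<cong> free_Abelian_group {..<m}"
  then have "free_Abelian_group {..<m} \<cong> free_Abelian_group {..<n}"
    using iso \<open>group A\<close> group.iso_sym iso_trans by blast
  then have "{..<m} \<approx> {..<n}"
    by (simp add: isomorphic_free_Abelian_groups)
  then show "m = n"
    using eqpoll_iff_card[of "{..<m}" "{..<n}"] by simp
qed (rule iso)

definition endo_rank :: "('a, 'b) monoid_scheme \<Rightarrow> ('a \<Rightarrow> 'a) \<Rightarrow> nat" where
  "endo_rank A f = free_rank (A\<lparr>carrier := f ` carrier A\<rparr>)"

text \<open>The difference of two endomorphisms of an abelian group, here in multiplicative notation.\<close>

definition endo_diff ::
    "('a, 'b) monoid_scheme \<Rightarrow> ('a \<Rightarrow> 'a) \<Rightarrow> ('a \<Rightarrow> 'a) \<Rightarrow> 'a \<Rightarrow> 'a" where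
  "endo_diff A f h x = f x \<otimes>\<^bsub>A\<^esub> inv\<^bsub>A\<^esub> (h x)"

text \<open>The endomorphism \<open>Id - \<tau>\<^sub>g \<circ> \<phi>\<close> of \<open>N\<close> depends only on the coset of \<open>g\<close>, so for
  each coset the representative \<open>g\<close> below contributes a single value.\<close>

definition min_twisted_rank ::
    "('a, 'b) monoid_scheme \<Rightarrow> 'a set \<Rightarrow> ('a \<Rightarrow> 'a) \<Rightarrow> nat" where
  "min_twisted_rank G N \<phi> =
     Min {endo_rank (G\<lparr>carrier := N\<rparr>) (endo_diff (G\<lparr>carrier := N\<rparr>) id (conjugation G g \<circ> \<phi>)) |
            C g. C \<in> carrier (G Mod N) \<and> g \<in> C}"

end

theory Submission
  imports Defs
begin

text \<open>
  Write \<open>N\<close> additively and \<open>I\<^sub>g\<close> for the image of \<open>Id - \<tau>\<^sub>g \<circ> \<phi>\<close> on \<open>N\<close>. For \<open>x, z \<in> N\<close> one has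
  \<open>z x g \<phi>(z)\<^sup>-\<^sup>1 = (x + z - \<tau>\<^sub>g(\<phi> z)) g\<close>, so twisting \<open>x g\<close> by elements of \<open>N\<close> moves \<open>x\<close> exactly
  through its coset of \<open>I\<^sub>g\<close>. Twisting by all of \<open>G\<close> merges at most \<open>[G : N]\<close> of these cosets into
  one class, because an arbitrary \<open>z\<close> is an element of \<open>N\<close> times one of finitely many coset
  representatives (\<open>twisted_class_cong\<close>, \<open>card_twisted_class_fibre\<close>). Up to constants, the
  twisted conjugacy growth is therefore the sum over the cosets \<open>N g\<close> of the number of cosets of
  \<open>I\<^sub>g\<close> that meet a ball in \<open>N\<close>.

  The word metric of \<open>G\<close> restricted to \<open>N\<close> is comparable to the \<open>\<ell>\<^sup>1\<close> length with respect to a finite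
  generating set of \<open>N\<close>: Schreier's rewriting turns a word of length \<open>k\<close> in \<open>G\<close> into a product of \<open>k\<close>
  Schreier generators and a coset representative (\<open>schreier_decomposition\<close>), and each of the
  finitely many generators has bounded length in \<open>G\<close> (\<open>comb_ball_word_length\<close>).

  It remains to count cosets of a subgroup \<open>I\<close> in a finitely generated torsion-free abelian group.
  Let \<open>E\<close> be a maximal set of generators that is independent modulo \<open>I\<close>. Distinct combinations of
  \<open>E\<close> lie in distinct cosets, which gives at least \<open>(k + 1)\<^bsup>|E|\<^esup>\<close> cosets in a ball of radius
  proportional to \<open>k\<close>; and a fixed multiple of every generator lies in \<open>I + \<langle>E\<rangle>\<close>, which gives at most
  a constant times \<open>k\<^bsup>|E|\<^esup>\<close> (\<open>coset_count_lower\<close>, \<open>coset_count_upper\<close>). Comparing these two bounds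
  with each other also replaces all linear algebra: the growth exponent bounds the size of an
  independent set by that of a spanning one, whence \<open>|E| + rank I = rank N\<close>
  (\<open>rank_additive\<close>). So the coset \<open>N g\<close> contributes \<open>r\<close> to the power
  \<open>rank N - rank I\<^sub>g\<close>, the largest exponent wins, and the case \<open>I = 0\<close> gives the growth of \<open>G\<close> itself.
\<close>

section \<open>Integer combinations in abelian groups\<close>

text \<open>
  Combinations carry coefficients on the set of generators itself rather than on an enumeration of
  it, so that sets of generators can be united, shrunk and exchanged without reindexing.
\<close>
definition int_comb :: "('a, 'b) monoid_scheme \<Rightarrow> 'a set \<Rightarrow> ('a \<Rightarrow> int) \<Rightarrow> 'a" where
  "int_comb A E c = finprod A (\<lambda>e. e [^]\<^bsub>A\<^esub> c e) E"

definition int_span :: "('a, 'b) monoid_scheme \<Rightarrow> 'a set \<Rightarrow> 'a set" where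
  "int_span A E = range (int_comb A E)"

text \<open>
  For \<open>I = {\<one>}\<close> this is the usual linear independence over the integers.
\<close>
definition indep_mod :: "('a, 'b) monoid_scheme \<Rightarrow> 'a set \<Rightarrow> 'a set \<Rightarrow> bool" where
  "indep_mod A I E \<longleftrightarrow> finite E \<and> E \<subseteq> carrier A \<and>
     (\<forall>c. int_comb A E c \<in> I \<longrightarrow> (\<forall>e\<in>E. c e = 0))"

lemma (in group) torsion_free_int_pow:
  assumes "torsion_free G" "x \<in> carrier G" "(n::int) \<noteq> 0" "x [^] n = \<one>"
  shows "x = \<one>"
proof -
  have "x [^] nat \<bar>n\<bar> = \<one>"
  proof (cases "n > 0")
    case True
    then show ?thesis using assms(4) by (simp only: int_pow_def2[of G x n]) simp
  next
    case False
    then have "inv (x [^] nat \<bar>n\<bar>) = \<one>"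
      using assms(3,4) by (simp only: int_pow_def2[of G x n]) (simp split: if_splits)
    then show ?thesis using inv_eq_1_iff[OF nat_pow_closed[OF assms(2)]] by blast
  qed
  moreover have "0 < nat \<bar>n\<bar>" using assms(3) by simp
  ultimately show ?thesis using assms(1,2) unfolding torsion_free_def by blast
qed

context comm_group
begin

lemma pow_funcset: "E \<subseteq> carrier G \<Longrightarrow> (\<lambda>e. e [^] (c e :: int)) \<in> E \<rightarrow> carrier G"
  by auto

lemma int_comb_closed [simp]: "E \<subseteq> carrier G \<Longrightarrow> int_comb G E c \<in> carrier G"
  unfolding int_comb_def by (intro finprod_closed pow_funcset)

lemma int_comb_cong:
  "E \<subseteq> carrier G \<Longrightarrow> (\<And>e. e \<in> E \<Longrightarrow> c e = d e) \<Longrightarrow> int_comb G E c = int_comb G E d"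
  unfolding int_comb_def by (intro finprod_cong') (auto intro: pow_funcset)

lemma int_comb_empty [simp]: "int_comb G {} c = \<one>"
  by (simp add: int_comb_def)

lemma int_comb_insert:
  "finite E \<Longrightarrow> e \<notin> E \<Longrightarrow> e \<in> carrier G \<Longrightarrow> E \<subseteq> carrier G \<Longrightarrow>
     int_comb G (insert e E) c = e [^] c e \<otimes> int_comb G E c"
  unfolding int_comb_def by (intro finprod_insert) auto

lemma int_comb_remove:
  assumes "finite E" "e \<in> E" "E \<subseteq> carrier G"
  shows "int_comb G E c = e [^] c e \<otimes> int_comb G (E - {e}) c"
  using int_comb_insert[of "E - {e}" e c] assms by (auto simp: insert_absorb)

lemma int_comb_add:
  "E \<subseteq> carrier G \<Longrightarrow> int_comb G E (\<lambda>e. c e + d e) = int_comb G E c \<otimes> int_comb G E d"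
  unfolding int_comb_def
  by (subst finprod_multf[symmetric]) (auto intro!: finprod_cong' simp: int_pow_mult)

lemma int_comb_zero: "E \<subseteq> carrier G \<Longrightarrow> (\<And>e. e \<in> E \<Longrightarrow> c e = 0) \<Longrightarrow> int_comb G E c = \<one>"
  unfolding int_comb_def by (intro finprod_one_eqI) auto

lemma int_comb_scale:
  assumes "E \<subseteq> carrier G"
  shows "int_comb G E (\<lambda>e. n * c e) = int_comb G E c [^] n"
proof (cases "finite E")
  case True
  then show ?thesis using assms
  proof (induction E)
    case (insert e E)
    then show ?case
      by (simp add: int_comb_insert int_pow_distrib int_pow_pow mult.commute)
  qed simp
next
  case False
  then show ?thesis by (simp add: int_comb_def)
qed

lemma int_comb_minus:
  "E \<subseteq> carrier G \<Longrightarrow> int_comb G E (\<lambda>e. - c e) = inv (int_comb G E c)"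
  using int_comb_scale[of E "-1" c] by (simp add: int_pow_neg)

lemma int_comb_diff:
  "E \<subseteq> carrier G \<Longrightarrow> int_comb G E (\<lambda>e. c e - d e) = int_comb G E c \<otimes> inv (int_comb G E d)"
  using int_comb_add[of E c "\<lambda>e. - d e"] by (simp add: int_comb_minus)

lemma int_comb_Un:
  assumes "finite E" "finite F" "E \<inter> F = {}" "E \<subseteq> carrier G" "F \<subseteq> carrier G"
  shows "int_comb G (E \<union> F) c = int_comb G E c \<otimes> int_comb G F c"
  unfolding int_comb_def using assms by (intro finprod_Un_disjoint pow_funcset)

lemma int_comb_single:
  assumes "finite E" "e \<in> E" "E \<subseteq> carrier G"
  shows "int_comb G E (\<lambda>x. if x = e then n else 0) = e [^] n"
proof -
  have "int_comb G (E - {e}) (\<lambda>x. if x = e then n else 0) = \<one>"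
    using assms by (intro int_comb_zero) auto
  then show ?thesis using assms by (subst int_comb_remove[of _ e]) auto
qed

lemma int_comb_comb:
  assumes "E \<subseteq> carrier G"
  shows "int_comb G E (\<lambda>e. \<Sum>y\<in>Y. q y * c y e) = finprod G (\<lambda>y. int_comb G E (c y) [^] q y) Y"
proof (cases "finite Y")
  case True
  then show ?thesis
  proof (induction Y)
    case empty
    then show ?case using assms by (simp add: int_comb_zero)
  next
    case (insert y Y)
    have "int_comb G E (\<lambda>e. \<Sum>y\<in>insert y Y. q y * c y e)
          = int_comb G E (\<lambda>e. q y * c y e + (\<Sum>y\<in>Y. q y * c y e))"
      using insert by simp
    also have "\<dots> = int_comb G E (c y) [^] q y \<otimes> finprod G (\<lambda>y. int_comb G E (c y) [^] q y) Y"
      using insert assms by (simp add: int_comb_add int_comb_scale)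
    also have "\<dots> = finprod G (\<lambda>y. int_comb G E (c y) [^] q y) (insert y Y)"
      using insert assms by (intro finprod_insert[symmetric]) auto
    finally show ?case .
  qed
next
  case False
  then show ?thesis using assms by (simp add: int_comb_zero)
qed

lemma subgroup_int_span:
  assumes "E \<subseteq> carrier G"
  shows "subgroup (int_span G E) G"
proof
  show "int_span G E \<subseteq> carrier G"
    using assms by (auto simp: int_span_def)
  show "\<one> \<in> int_span G E"
    unfolding int_span_def using int_comb_zero[OF assms, of "\<lambda>_. 0"] by (metis rangeI)
next
  fix x y assume "x \<in> int_span G E" "y \<in> int_span G E"
  then show "x \<otimes> y \<in> int_span G E"
    unfolding int_span_def by (auto simp flip: int_comb_add[OF assms])
next
  fix x assume "x \<in> int_span G E"
  then show "inv x \<in> int_span G E"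
    unfolding int_span_def by (auto simp flip: int_comb_minus[OF assms])
qed

lemma int_span_superset: "finite E \<Longrightarrow> E \<subseteq> carrier G \<Longrightarrow> E \<subseteq> int_span G E"
  unfolding int_span_def using int_comb_single[of E _ 1]
  by (metis int_pow_1 rangeI subset_eq)

lemma int_span_minimal:
  assumes "subgroup H G" "E \<subseteq> H"
  shows "int_span G E \<subseteq> H"
proof -
  have "int_comb G E c \<in> H" for c
  proof (cases "finite E")
    case True
    then show ?thesis using assms(2)
    proof (induction E)
      case empty
      then show ?case using assms(1) by (simp add: subgroup.one_closed)
    next
      case (insert e E)
      then show ?case
        using assms(1) subgroup.subset[OF assms(1)] 
        by (subst int_comb_insert) (auto intro!: subgroup.m_closed subgroup_int_pow_closed)
    qed
  next
    case False
    then show ?thesis using assms(1) by (simp add: int_comb_def subgroup.one_closed)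
  qed
  then show ?thesis by (auto simp: int_span_def)
qed

lemma int_span_eqI:
  assumes "finite E" "finite F" "E \<subseteq> carrier G" "F \<subseteq> carrier G"
    "E \<subseteq> int_span G F" "F \<subseteq> int_span G E"
  shows "int_span G E = int_span G F"
  using assms by (meson int_span_minimal subgroup_int_span subset_antisym)

section \<open>Bases of finitely generated torsion-free abelian groups\<close>

lemma int_span_exchange:
  assumes E: "finite E" "E \<subseteq> carrier G" and ef: "e \<in> E" "f \<in> E" "e \<noteq> f"
  shows "int_span G (insert (f \<otimes> e [^] (s::int)) (E - {f})) = int_span G E"
proof (rule int_span_eqI)
  let ?E = "insert (f \<otimes> e [^] s) (E - {f})"
  show E': "?E \<subseteq> carrier G" using assms by auto
  interpret S: subgroup "int_span G E" G using E(2) by (rule subgroup_int_span)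
  interpret S': subgroup "int_span G ?E" G using E' by (rule subgroup_int_span)
  have sup: "E \<subseteq> int_span G E" using E by (rule int_span_superset)
  have sup': "?E \<subseteq> int_span G ?E" using E E' by (intro int_span_superset) auto
  show "?E \<subseteq> int_span G E"
    using sup ef by (auto intro!: S.m_closed subgroup_int_pow_closed[OF S.subgroup_axioms])
  have "(f \<otimes> e [^] s) \<otimes> e [^] (- s) = f"
    using E ef by (simp add: m_assoc int_pow_neg subset_iff)
  moreover have "(f \<otimes> e [^] s) \<otimes> e [^] (- s) \<in> int_span G ?E"
    using sup' ef by (intro S'.m_closed[of "f \<otimes> e [^] s"]
        subgroup_int_pow_closed[OF S'.subgroup_axioms]) auto
  ultimately have "f \<in> int_span G ?E" by metis
  then show "E \<subseteq> int_span G ?E" using sup' by auto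
qed (use E in auto)

text \<open>
  The Euclidean algorithm on the coefficients of a relation. For coefficients
  \<open>0 < \<bar>c f\<bar> \<le> \<bar>c e\<bar>\<close>, exchanging the generator \<open>f\<close> for \<open>f \<plusminus> e\<close> replaces \<open>c e\<close> by \<open>c e \<mp> c f\<close> and
  keeps the other coefficients, so with the right sign the sum of absolute values drops. Once a
  single nonzero coefficient is left, torsion-freeness makes the corresponding generator trivial,
  and it can be omitted.
\<close>
lemma relation_reduces_generators:
  assumes tf: "torsion_free G"
    and "finite E" "E \<subseteq> carrier G" "int_comb G E c = \<one>" "e \<in> E" "c e \<noteq> 0"
  shows "\<exists>F. finite F \<and> F \<subseteq> carrier G \<and> card F < card E \<and> int_span G F = int_span G E"
  using assms(2-)
proof (induction "nat (\<Sum>e\<in>E. \<bar>c e\<bar>)" arbitrary: E c e rule: less_induct)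
  case less
  note E = less.prems(1,2)
  show ?case
  proof (cases "\<forall>f\<in>E - {e}. c f = 0")
    case True
    have "int_comb G (E - {e}) c = \<one>" using E True by (intro int_comb_zero) auto
    then have "int_comb G E c = e [^] c e"
      using less.prems by (subst int_comb_remove[of _ e]) auto
    then have e: "e = \<one>" using torsion_free_int_pow[OF tf] less.prems by auto
    have "int_span G (E - {e}) = int_span G E"
    proof (rule int_span_eqI)
      have "\<one> \<in> int_span G (E - {e})"
        using E by (intro subgroup.one_closed subgroup_int_span) auto
      moreover have "E - {e} \<subseteq> int_span G (E - {e})" using E by (intro int_span_superset) auto
      ultimately show "E \<subseteq> int_span G (E - {e})" using e by auto
      show "E - {e} \<subseteq> int_span G E" using int_span_superset[OF E] by auto
    qed (use E in auto)
    then show ?thesis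
      using E less.prems(4) by (intro exI[of _ "E - {e}"]) (auto simp: card_Diff1_less simp del: card_Diff_insert)
  next
    case False
    obtain e f where ef: "e \<in> E" "f \<in> E" "e \<noteq> f" "c e \<noteq> 0" "c f \<noteq> 0" "\<bar>c f\<bar> \<le> \<bar>c e\<bar>"
    proof -
      from False obtain f where "f \<in> E" "f \<noteq> e" "c f \<noteq> 0" by auto
      then show ?thesis using that[of e f] that[of f e] less.prems(4,5) by fastforce
    qed
    have efc: "e \<in> carrier G" "f \<in> carrier G" using ef E by auto
    \<comment> \<open>the sign for which \<open>c e - s * c f\<close> has absolute value \<open>\<bar>c e\<bar> - \<bar>c f\<bar>\<close>\<close>
    define s where "s = sgn (c e) * sgn (c f)"
    define g where "g = f \<otimes> e [^] s"
    define F where "F = insert g (E - {f})"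
    have gc: "g \<in> carrier G" using efc by (simp add: g_def)
    have F: "finite F" "F \<subseteq> carrier G" using E gc by (auto simp: F_def)
    have spanF: "int_span G F = int_span G E"
      unfolding F_def g_def using E ef by (intro int_span_exchange)
    \<comment> \<open>a coincidence of the new generator with an old one already makes the set smaller\<close>
    show ?thesis
    proof (cases "g \<in> E - {f}")
      case True
      then have "F = E - {f}" by (auto simp: F_def)
      then have "card F < card E" using E ef by (simp add: card_Diff1_less del: card_Diff_insert)
      then show ?thesis using F spanF by blast
    next
      case False
      have eg: "e \<noteq> g" using False ef by auto
      define R where "R = E - {e, f}"
      have R: "finite R" "R \<subseteq> carrier G" "e \<notin> R" "f \<notin> R" "g \<notin> R"
        using E False by (auto simp: R_def)
      have Eeq: "E = insert e (insert f R)" using ef by (auto simp: R_def)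
      have Feq: "F = insert e (insert g R)" using ef by (auto simp: R_def F_def)
      have cardF: "card F = card E" using R ef(3) eg by (simp add: Eeq Feq)
      define d where "d = c(e := c e - s * c f, g := c f)"
      have dR: "d x = c x" if "x \<in> R" for x using that R by (auto simp: d_def)
      have combR: "int_comb G R d = int_comb G R c" using dR R by (intro int_comb_cong) auto
      have de: "d e = c e - s * c f" and dg: "d g = c f" using eg by (auto simp: d_def)
      have "int_comb G F d = e [^] d e \<otimes> (g [^] d g \<otimes> int_comb G R c)"
        using R efc gc eg by (simp add: Feq int_comb_insert combR)
      also have "g [^] d g = f [^] c f \<otimes> e [^] (s * c f)"
        unfolding dg using efc by (simp add: g_def int_pow_distrib int_pow_pow)
      also have "e [^] d e \<otimes> (f [^] c f \<otimes> e [^] (s * c f) \<otimes> int_comb G R c)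
                 = (e [^] d e \<otimes> e [^] (s * c f)) \<otimes> (f [^] c f \<otimes> int_comb G R c)"
        using efc R by (simp add: m_ac)
      also have "e [^] d e \<otimes> e [^] (s * c f) = e [^] c e"
        using efc by (simp add: de flip: int_pow_mult)
      also have "e [^] c e \<otimes> (f [^] c f \<otimes> int_comb G R c) = int_comb G E c"
        using R efc ef(3) by (simp add: Eeq int_comb_insert)
      finally have rel: "int_comb G F d = \<one>" using less.prems by simp
      have "\<bar>d e\<bar> < \<bar>c e\<bar>"
        using ef(4-6) unfolding de s_def by (auto simp: sgn_if abs_if split: if_splits)
      then have "(\<Sum>x\<in>F. \<bar>d x\<bar>) < (\<Sum>x\<in>E. \<bar>c x\<bar>)"
        using R ef(3) eg dR dg by (simp add: Eeq Feq)
      moreover have "0 \<le> (\<Sum>x\<in>F. \<bar>d x\<bar>)" by (intro sum_nonneg) auto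
      ultimately have "nat (\<Sum>x\<in>F. \<bar>d x\<bar>) < nat (\<Sum>x\<in>E. \<bar>c x\<bar>)" by linarith
      from less.hyps[OF this F rel, of g] dg ef(5) show ?thesis
        by (auto simp: F_def cardF[unfolded F_def] spanF[unfolded F_def])
    qed
  qed
qed

lemma ex_basis:
  assumes tf: "torsion_free G"
    and "finite E" "E \<subseteq> carrier G"
  shows "\<exists>B. indep_mod G {\<one>} B \<and> int_span G B = int_span G E"
  using assms(2,3)
proof (induction "card E" arbitrary: E rule: less_induct)
  case less
  show ?case
  proof (cases "indep_mod G {\<one>} E")
    case False
    then obtain c e where "int_comb G E c = \<one>" "e \<in> E" "c e \<noteq> 0"
      using less.prems by (auto simp: indep_mod_def)
    then obtain F where "finite F" "F \<subseteq> carrier G" "card F < card E" "int_span G F = int_span G E"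
      using relation_reduces_generators[OF tf] less.prems by metis
    then show ?thesis using less.hyps[of F] by auto
  qed auto
qed

text \<open>
  Elements of the free abelian group on \<open>B\<close> are finitely supported coefficient functions, so
  forming the combination is an isomorphism onto the span.
\<close>
lemma free_rank_int_span:
  assumes "indep_mod G {\<one>} B"
  shows "free_rank (G\<lparr>carrier := int_span G B\<rparr>) = card B"
proof (rule free_rank_eqI)
  have B: "finite B" "B \<subseteq> carrier G" using assms by (auto simp: indep_mod_def)
  have sub: "subgroup (int_span G B) G" using B by (intro subgroup_int_span)
  show grp: "group (G\<lparr>carrier := int_span G B\<rparr>)" using sub by (rule subgroup_imp_group)
  define h where "h x = int_comb G B (Poly_Mapping.lookup x)" for x
  have "h \<in> iso (free_Abelian_group B) (G\<lparr>carrier := int_span G B\<rparr>)"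
  proof (rule isoI)
    show "h \<in> hom (free_Abelian_group B) (G\<lparr>carrier := int_span G B\<rparr>)"
      using B by (intro homI) (auto simp: h_def int_span_def lookup_add[abs_def] int_comb_add)
    have "inj_on h (carrier (free_Abelian_group B))"
    proof (rule inj_onI)
      fix x y assume "x \<in> carrier (free_Abelian_group B)" "y \<in> carrier (free_Abelian_group B)"
        and "h x = h y"
      then have keys: "Poly_Mapping.keys x \<subseteq> B" "Poly_Mapping.keys y \<subseteq> B"
        and "int_comb G B (\<lambda>e. Poly_Mapping.lookup x e - Poly_Mapping.lookup y e) = \<one>"
        using B by (auto simp: int_comb_diff h_def)
      then have "\<forall>e\<in>B. Poly_Mapping.lookup x e = Poly_Mapping.lookup y e"
        using assms by (force simp: indep_mod_def)
      then show "x = y"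
        using keys by (intro poly_mapping_eqI) (metis in_keys_iff subsetD)
    qed
    moreover have "h ` carrier (free_Abelian_group B) = int_span G B"
    proof -
      have "int_comb G B c \<in> h ` carrier (free_Abelian_group B)" for c
      proof -
        let ?c = "\<lambda>e. if e \<in> B then c e else 0"
        define x where "x = Abs_poly_mapping ?c"
        have "finite {e. ?c e \<noteq> 0}" by (rule finite_subset[OF _ B(1)]) auto
        then have x: "Poly_Mapping.lookup x = ?c" by (simp add: x_def)
        have "Poly_Mapping.keys x \<subseteq> B" using x by (auto simp: in_keys_iff split: if_splits)
        moreover have "int_comb G B c = h x" unfolding h_def x using B by (intro int_comb_cong) auto
        ultimately show ?thesis by auto
      qed
      then show ?thesis by (auto simp: int_span_def h_def)
    qed
    ultimately show "bij_betw h (carrier (free_Abelian_group B))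
        (carrier (G\<lparr>carrier := int_span G B\<rparr>))"
      by (simp add: bij_betw_def)
  qed
  then have "free_Abelian_group B \<cong> G\<lparr>carrier := int_span G B\<rparr>" by (auto simp: is_iso_def)
  then have "G\<lparr>carrier := int_span G B\<rparr> \<cong> free_Abelian_group B"
    using group.iso_sym group_free_Abelian_group by blast
  moreover have "B \<approx> {..<card B}"
    using B(1) by (simp add: eqpoll_iff_card)
  then have "free_Abelian_group B \<cong> free_Abelian_group {..<card B}"
    by (simp add: isomorphic_free_Abelian_groups)
  ultimately show "G\<lparr>carrier := int_span G B\<rparr> \<cong> free_Abelian_group {..<card B}"
    using iso_trans by blast
qed

end

section \<open>Counting the cosets that meet a ball\<close>

text \<open>
  The ball of radius \<open>k\<close> in the word metric of the abelian group generated by \<open>Y\<close>, described by the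
  \<open>\<ell>\<^sup>1\<close> norm of coefficients.
\<close>
definition comb_ball :: "('a, 'b) monoid_scheme \<Rightarrow> 'a set \<Rightarrow> nat \<Rightarrow> 'a set" where
  "comb_ball A Y k = {int_comb A Y c | c. (\<Sum>y\<in>Y. \<bar>c y\<bar>) \<le> int k}"

text \<open>
  For finite \<open>Y\<close> and a subgroup \<open>I\<close> of an abelian group, this says that \<open>E\<close> spans the image of \<open>Y\<close>
  in the quotient by \<open>I\<close> over the rationals.
\<close>
definition spans_mod :: "('a, 'b) monoid_scheme \<Rightarrow> 'a set \<Rightarrow> 'a set \<Rightarrow> 'a set \<Rightarrow> bool" where
  "spans_mod A I E Y \<longleftrightarrow> finite E \<and> E \<subseteq> carrier A \<and>
     (\<exists>M>0. \<forall>y\<in>Y. \<exists>i\<in>I. \<exists>c. y [^]\<^bsub>A\<^esub> (M::int) = i \<otimes>\<^bsub>A\<^esub> int_comb A E c)"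

lemma (in group) rcos_eq_iff:
  assumes "subgroup I G" "x \<in> carrier G" "y \<in> carrier G"
  shows "I #> x = I #> y \<longleftrightarrow> x \<otimes> inv y \<in> I"
proof
  assume "I #> x = I #> y"
  then have "x \<in> I #> y" using rcos_self[OF assms(2,1)] by simp
  then show "x \<otimes> inv y \<in> I"
    by (rule subgroup.rcos_module_imp[OF assms(1) group_axioms assms(3)])
next
  assume "x \<otimes> inv y \<in> I"
  then have "x \<in> I #> y"
    by (rule subgroup.rcos_module_rev[OF assms(1) group_axioms assms(3,2)])
  then show "I #> x = I #> y" using repr_independence[OF _ assms(3,1)] by simp
qed

text \<open>
  Used to compare sizes of independent and spanning sets through the growth they force.
\<close>
lemma exponent_le:
  assumes "\<And>k::nat. k \<ge> 1 \<Longrightarrow> (k + 1) ^ p \<le> D * k ^ q"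
  shows "p \<le> q"
proof (rule ccontr)
  assume "\<not> p \<le> q"
  define k where "k = D + 1"
  have "k * k ^ q = k ^ Suc q" by simp
  also have "\<dots> \<le> k ^ p" using \<open>\<not> p \<le> q\<close> by (intro power_increasing) (auto simp: k_def)
  also have "\<dots> \<le> (k + 1) ^ p" by (intro power_mono) auto
  also have "\<dots> \<le> D * k ^ q" by (intro assms) (auto simp: k_def)
  finally show False by (simp add: k_def)
qed

context comm_group
begin

lemma comb_ball_mono: "j \<le> k \<Longrightarrow> comb_ball G Y j \<subseteq> comb_ball G Y k"
  unfolding comb_ball_def by force

lemma comb_ball_subset: "Y \<subseteq> carrier G \<Longrightarrow> comb_ball G Y k \<subseteq> carrier G"
  by (auto simp: comb_ball_def)

lemma one_in_comb_ball:
  assumes "Y \<subseteq> carrier G" shows "\<one> \<in> comb_ball G Y k"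
proof -
  have "\<one> = int_comb G Y (\<lambda>_. 0)" using assms by (simp add: int_comb_zero)
  then show ?thesis unfolding comb_ball_def by force
qed

lemma comb_ball_mult:
  assumes Y: "Y \<subseteq> carrier G" and "x \<in> comb_ball G Y j" "y \<in> comb_ball G Y k"
  shows "x \<otimes> y \<in> comb_ball G Y (j + k)"
proof -
  obtain c d where *: "x = int_comb G Y c" "(\<Sum>y\<in>Y. \<bar>c y\<bar>) \<le> int j"
    "y = int_comb G Y d" "(\<Sum>y\<in>Y. \<bar>d y\<bar>) \<le> int k"
    using assms by (auto simp: comb_ball_def)
  have "(\<Sum>y\<in>Y. \<bar>c y + d y\<bar>) \<le> (\<Sum>y\<in>Y. \<bar>c y\<bar> + \<bar>d y\<bar>)"
    by (intro sum_mono) auto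
  also have "\<dots> \<le> int (j + k)" using * by (simp add: sum.distrib)
  finally show ?thesis unfolding comb_ball_def using * Y
    by (auto simp flip: int_comb_add)
qed

lemma comb_ball_pow:
  assumes Y: "Y \<subseteq> carrier G" and "x \<in> comb_ball G Y j"
  shows "x [^] (n::int) \<in> comb_ball G Y (nat \<bar>n\<bar> * j)"
proof -
  obtain c where *: "x = int_comb G Y c" "(\<Sum>y\<in>Y. \<bar>c y\<bar>) \<le> int j"
    using assms by (auto simp: comb_ball_def)
  have "(\<Sum>y\<in>Y. \<bar>n * c y\<bar>) = \<bar>n\<bar> * (\<Sum>y\<in>Y. \<bar>c y\<bar>)"
    by (simp add: abs_mult sum_distrib_left)
  also have "\<dots> \<le> \<bar>n\<bar> * int j" using * by (intro mult_left_mono) auto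
  finally show ?thesis unfolding comb_ball_def using * Y
    by (auto simp flip: int_comb_scale)
qed

lemma comb_ball_finprod:
  assumes Y: "Y \<subseteq> carrier G" and "finite E" "\<And>e. e \<in> E \<Longrightarrow> f e \<in> comb_ball G Y (l e)"
  shows "finprod G f E \<in> comb_ball G Y (\<Sum>e\<in>E. l e)"
  using assms(2,3)
proof (induction E)
  case empty
  then show ?case using one_in_comb_ball[OF Y] by simp
next
  case (insert e E)
  have "f e' \<in> carrier G" if "e' \<in> insert e E" for e'
    using insert.prems[OF that] comb_ball_subset[OF Y] by blast
  then have "finprod G f (insert e E) = f e \<otimes> finprod G f E"
    using insert.hyps by (intro finprod_insert) auto
  then show ?case using insert comb_ball_mult[OF Y] by simp
qed

lemma int_span_comb_ball: "x \<in> int_span G Y \<Longrightarrow> \<exists>k. x \<in> comb_ball G Y k"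
proof -
  assume "x \<in> int_span G Y"
  then obtain c where x: "x = int_comb G Y c" by (auto simp: int_span_def)
  have "(\<Sum>y\<in>Y. \<bar>c y\<bar>) \<le> int (nat (\<Sum>y\<in>Y. \<bar>c y\<bar>))" by linarith
  then show ?thesis using x unfolding comb_ball_def by blast
qed

lemma int_comb_PiE:
  assumes "Y \<subseteq> carrier G" "\<And>y. y \<in> Y \<Longrightarrow> c y \<in> D"
  shows "int_comb G Y c \<in> int_comb G Y ` (Y \<rightarrow>\<^sub>E D)"
proof (rule image_eqI)
  show "restrict c Y \<in> Y \<rightarrow>\<^sub>E D" using assms(2) by auto
  show "int_comb G Y c = int_comb G Y (restrict c Y)"
    using assms(1) by (intro int_comb_cong) auto
qed

lemma finite_comb_ball:
  assumes "finite Y" "Y \<subseteq> carrier G"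
  shows "finite (comb_ball G Y k)"
proof (rule finite_subset)
  show "comb_ball G Y k \<subseteq> int_comb G Y ` (Y \<rightarrow>\<^sub>E {- int k..int k})"
  proof
    fix x assume "x \<in> comb_ball G Y k"
    then obtain c where x: "x = int_comb G Y c" and c: "(\<Sum>y\<in>Y. \<bar>c y\<bar>) \<le> int k"
      by (auto simp: comb_ball_def)
    have "\<bar>c y\<bar> \<le> int k" if "y \<in> Y" for y
      using member_le_sum[of y Y "\<lambda>y. \<bar>c y\<bar>"] that c assms by auto
    then show "x \<in> int_comb G Y ` (Y \<rightarrow>\<^sub>E {- int k..int k})"
      unfolding x using assms(2) by (intro int_comb_PiE) force+
  qed
  show "finite (int_comb G Y ` (Y \<rightarrow>\<^sub>E {- int k..int k}))"
    using assms by (intro finite_imageI finite_PiE) auto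
qed

text \<open>
  The combinations of \<open>E\<close> with coefficients in \<open>{0..k}\<close> lie in pairwise distinct cosets by
  independence, and in a ball of radius proportional to \<open>k\<close> because each element of \<open>E\<close> has a fixed
  length.
\<close>
lemma coset_count_lower:
  assumes I: "subgroup I G" and Y: "finite Y" "Y \<subseteq> carrier G"
    and E: "indep_mod G I E" "E \<subseteq> int_span G Y"
  shows "\<exists>C>0. \<forall>k. (k + 1) ^ card E \<le> card ((#>) I ` comb_ball G Y (C * k))"
proof -
  have Ef: "finite E" "E \<subseteq> carrier G" using E by (auto simp: indep_mod_def)
  obtain l where l: "\<And>e. e \<in> E \<Longrightarrow> e \<in> comb_ball G Y (l e)"
    using bchoice[of E "\<lambda>e k. e \<in> comb_ball G Y k"] int_span_comb_ball E(2) by blast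
  \<comment> \<open>the summand \<open>1\<close> keeps \<open>C\<close> positive when \<open>E\<close> is empty\<close>
  define C where "C = (\<Sum>e\<in>E. l e) + 1"
  have "(k + 1) ^ card E \<le> card ((#>) I ` comb_ball G Y (C * k))" for k
  proof -
    let ?P = "E \<rightarrow>\<^sub>E {0..int k}"
    have "inj_on (\<lambda>c. I #> int_comb G E c) ?P"
    proof (rule inj_onI)
      fix c d assume cd: "c \<in> ?P" "d \<in> ?P" and "I #> int_comb G E c = I #> int_comb G E d"
      then have "int_comb G E (\<lambda>e. c e - d e) \<in> I"
        using I Ef by (simp add: rcos_eq_iff int_comb_diff)
      then have "c e = d e" if "e \<in> E" for e
        using E(1) that by (auto simp: indep_mod_def)
      then show "c = d" using cd by (intro PiE_ext[of c E _ d]) auto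
    qed
    then have "card ((\<lambda>c. I #> int_comb G E c) ` ?P) = card ?P"
      by (rule card_image)
    also have "\<dots> = (\<Prod>e\<in>E. k + 1)"
      unfolding card_PiE[OF Ef(1)] by (intro prod.cong) auto
    finally have "card ((\<lambda>c. I #> int_comb G E c) ` ?P) = (k + 1) ^ card E"
      by simp
    moreover have "(\<lambda>c. I #> int_comb G E c) ` ?P \<subseteq> (#>) I ` comb_ball G Y (C * k)"
    proof -
      have "int_comb G E c \<in> comb_ball G Y (C * k)" if c: "c \<in> ?P" for c
      proof -
        have "e [^] c e \<in> comb_ball G Y (l e * k)" if e: "e \<in> E" for e
        proof -
          have "0 \<le> c e \<and> c e \<le> int k" using c e by (auto simp: PiE_iff)
          then have "nat \<bar>c e\<bar> \<le> k" by linarith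
          then have "nat \<bar>c e\<bar> * l e \<le> l e * k" by (simp add: mult.commute)
          then show ?thesis using comb_ball_pow[OF Y(2) l[OF e], of "c e"] comb_ball_mono by blast
        qed
        then have "int_comb G E c \<in> comb_ball G Y (\<Sum>e\<in>E. l e * k)"
          unfolding int_comb_def using Ef Y by (intro comb_ball_finprod)
        moreover have "(\<Sum>e\<in>E. l e * k) \<le> C * k"
          by (simp add: C_def sum_distrib_right)
        ultimately show ?thesis using comb_ball_mono by blast
      qed
      then show ?thesis by auto
    qed
    ultimately show ?thesis
      using finite_comb_ball[OF Y] by (metis card_mono finite_imageI)
  qed
  then show ?thesis by (intro exI[of _ C]) (auto simp: C_def)
qed

text \<open>
  Divide each coefficient of a combination of \<open>Y\<close> by \<open>M\<close>. Modulo \<open>I\<close> the quotients contribute a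
  combination of \<open>E\<close> with coefficients \<open>O(k)\<close>, and only finitely many values are possible for the
  remainders. The coset is determined by these two data.
\<close>
lemma coset_count_upper:
  assumes I: "subgroup I G" and Y: "finite Y" "Y \<subseteq> carrier G" and E: "spans_mod G I E Y"
  shows "\<exists>C. \<forall>k\<ge>1. card ((#>) I ` comb_ball G Y k) \<le> C * k ^ card E"
proof -
  interpret I: subgroup I G by (rule I)
  have Ef: "finite E" "E \<subseteq> carrier G" using E by (auto simp: spans_mod_def)
  obtain M where M: "M > 0" and "\<forall>y\<in>Y. \<exists>i\<in>I. \<exists>c. y [^] (M::int) = i \<otimes> int_comb G E c"
    using E by (auto simp: spans_mod_def)
  then obtain i c where i: "\<And>y. y \<in> Y \<Longrightarrow> i y \<in> I"
    and ic: "\<And>y. y \<in> Y \<Longrightarrow> y [^] M = i y \<otimes> int_comb G E (c y)"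
    by metis
  have iG: "\<And>y. y \<in> Y \<Longrightarrow> i y \<in> carrier G" using i by auto
  \<comment> \<open>a crude bound for all coefficients at once\<close>
  define D where "D = (\<Sum>y\<in>Y. \<Sum>e\<in>E. \<bar>c y e\<bar>)"
  have D0: "D \<ge> 0" unfolding D_def by (intro sum_nonneg) auto
  have D: "\<bar>c y e\<bar> \<le> D" if "y \<in> Y" "e \<in> E" for y e
  proof -
    have "\<bar>c y e\<bar> \<le> (\<Sum>e\<in>E. \<bar>c y e\<bar>)" using that Ef by (intro member_le_sum) auto
    moreover have "\<dots> \<le> D" unfolding D_def using that Y
      by (intro member_le_sum[of y Y "\<lambda>y. \<Sum>e\<in>E. \<bar>c y e\<bar>"]) (auto intro: sum_nonneg)
    ultimately show ?thesis by linarith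
  qed
  define P where "P k = (E \<rightarrow>\<^sub>E {- (D * int k)..D * int k})" for k :: nat
  define Q where "Q = (Y \<rightarrow>\<^sub>E {0..<M})"
  define C where "C = (2 * nat D + 1) ^ card E * nat M ^ card Y"
  have "card ((#>) I ` comb_ball G Y k) \<le> C * k ^ card E" if k: "k \<ge> 1" for k
  proof -
    have sub: "(#>) I ` comb_ball G Y k
        \<subseteq> (\<lambda>(b, r). I #> (int_comb G E b \<otimes> int_comb G Y r)) ` (P k \<times> Q)"
    proof safe
      fix x assume "x \<in> comb_ball G Y k"
      then obtain a where x: "x = int_comb G Y a" and a: "(\<Sum>y\<in>Y. \<bar>a y\<bar>) \<le> int k"
        by (auto simp: comb_ball_def)
      define q where "q y = a y div M" for y
      define r where "r y = a y mod M" for y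
      define b where "b e = (\<Sum>y\<in>Y. q y * c y e)" for e
      have qa: "\<bar>q y\<bar> \<le> \<bar>a y\<bar>" for y
      proof (cases "a y \<ge> 0")
        case True
        have "M * q y + r y = a y" by (simp add: q_def r_def)
        moreover have "r y \<ge> 0" using M by (simp add: r_def)
        moreover have q0: "q y \<ge> 0" using True M by (simp add: q_def pos_imp_zdiv_nonneg_iff)
        moreover have "1 * q y \<le> M * q y" using M q0 by (intro mult_right_mono) auto
        ultimately show ?thesis by linarith
      next
        case False
        have "a y \<le> q y"
        proof -
          have "M * q y + r y = a y" by (simp add: q_def r_def)
          moreover have "r y \<ge> 0" using M by (simp add: r_def)
          moreover have "q y < 0" using False M by (simp add: q_def pos_imp_zdiv_neg_iff)
          moreover have "r y < M" using M by (simp add: r_def)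
          moreover have "M * q y + r y \<le> q y"
          proof -
            have "(M - 1) * (q y + 1) \<le> 0" using M \<open>q y < 0\<close> by (intro mult_nonneg_nonpos) auto
            then show ?thesis using \<open>r y < M\<close> by (simp add: algebra_simps)
          qed
          ultimately show ?thesis by linarith
        qed
        moreover have "q y < 0" using False M by (simp add: q_def pos_imp_zdiv_neg_iff)
        ultimately show ?thesis by linarith
      qed
      have "x = int_comb G Y (\<lambda>y. M * q y + r y)" by (simp add: x q_def r_def)
      also have "\<dots> = int_comb G Y (\<lambda>y. M * q y) \<otimes> int_comb G Y r"
        using Y by (simp add: int_comb_add)
      also have "int_comb G Y (\<lambda>y. M * q y) = finprod G (\<lambda>y. (y [^] M) [^] q y) Y"
        unfolding int_comb_def using Y by (intro finprod_cong') (auto simp: int_pow_pow)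
      also have "\<dots> = finprod G (\<lambda>y. i y [^] q y \<otimes> int_comb G E (c y) [^] q y) Y"
        using Y Ef iG ic by (intro finprod_cong') (auto simp: int_pow_distrib)
      also have "\<dots> = finprod G (\<lambda>y. i y [^] q y) Y \<otimes> int_comb G E b"
        using Ef iG unfolding b_def by (simp add: Pi_iff int_comb_comb)
      finally have xeq: "x = finprod G (\<lambda>y. i y [^] q y) Y \<otimes> int_comb G E b \<otimes> int_comb G Y r" .
      have "finprod G (\<lambda>y. i y [^] q y) Y' \<in> I" if "Y' \<subseteq> Y" for Y'
        using finite_subset[OF that Y(1)] that
      proof (induction Y')
        case (insert y Y')
        then show ?case using i iG
          by (subst finprod_insert) (auto intro!: I.m_closed subgroup_int_pow_closed[OF I])
      qed auto
      then have iI: "finprod G (\<lambda>y. i y [^] q y) Y \<in> I" by simp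
      have coset: "I #> x = I #> (int_comb G E b \<otimes> int_comb G Y r)"
      proof -
        define j where "j = finprod G (\<lambda>y. i y [^] q y) Y"
        have j: "j \<in> I" "j \<in> carrier G" using iI by (auto simp: j_def)
        define z where "z = int_comb G E b \<otimes> int_comb G Y r"
        have z: "z \<in> carrier G" using Ef Y by (simp add: z_def)
        have "x = j \<otimes> z" unfolding xeq j_def[symmetric] z_def using j Ef Y by (simp add: m_assoc)
        then have "x \<otimes> inv z \<in> I" using j z by (simp add: m_assoc)
        then show ?thesis using z j \<open>x = j \<otimes> z\<close> I by (simp add: rcos_eq_iff flip: z_def)
      qed
      have "\<bar>b e\<bar> \<le> D * int k" if "e \<in> E" for e
      proof -
        have "\<bar>b e\<bar> \<le> (\<Sum>y\<in>Y. \<bar>q y * c y e\<bar>)" unfolding b_def by (rule sum_abs)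
        moreover have "\<dots> \<le> (\<Sum>y\<in>Y. \<bar>a y\<bar> * D)"
          using that D qa by (intro sum_mono) (auto simp: abs_mult intro!: mult_mono)
        moreover have "(\<Sum>y\<in>Y. \<bar>a y\<bar> * D) = D * (\<Sum>y\<in>Y. \<bar>a y\<bar>)" by (simp add: sum_distrib_left mult.commute)
        moreover have "\<dots> \<le> D * int k" using a D0 by (intro mult_left_mono)
        ultimately show ?thesis by linarith
      qed
      then have "restrict b E \<in> P k" by (force simp: P_def abs_le_iff)
      moreover have "restrict r Y \<in> Q" using M by (auto simp: Q_def r_def)
      moreover have "int_comb G E (restrict b E) = int_comb G E b"
        using Ef by (intro int_comb_cong) auto
      moreover have "int_comb G Y (restrict r Y) = int_comb G Y r"
        using Y by (intro int_comb_cong) auto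
      ultimately show "I #> x \<in> (\<lambda>(b, r). I #> (int_comb G E b \<otimes> int_comb G Y r)) ` (P k \<times> Q)"
        unfolding coset by (intro image_eqI[of _ _ "(restrict b E, restrict r Y)"]) auto
    qed
    have fin: "finite (P k \<times> Q)" unfolding P_def Q_def using Ef Y by (auto intro!: finite_PiE)
    have "card ((#>) I ` comb_ball G Y k) \<le> card (P k \<times> Q)"
      using card_mono[OF finite_imageI[OF fin] sub] card_image_le[OF fin] by (rule le_trans)
    also have "\<dots> = nat (2 * D * int k + 1) ^ card E * nat M ^ card Y"
      unfolding P_def Q_def using Ef Y by (simp add: card_cartesian_product card_PiE algebra_simps)
    also have "nat (2 * D * int k + 1) \<le> (2 * nat D + 1) * k"
      using D0 k by (simp add: nat_le_iff algebra_simps)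
    then have "nat (2 * D * int k + 1) ^ card E * nat M ^ card Y
               \<le> ((2 * nat D + 1) * k) ^ card E * nat M ^ card Y"
      by (intro mult_right_mono power_mono) auto
    also have "\<dots> = C * k ^ card E" by (simp add: C_def power_mult_distrib mult_ac del: mult_Suc mult_Suc_right)
    finally show ?thesis .
  qed
  then show ?thesis by blast
qed

text \<open>
  The Steinitz inequality by counting: \<open>E\<close> forces the number of cosets of \<open>I\<close> in a ball to grow at
  least with exponent \<open>|E|\<close>, and \<open>F\<close> allows at most exponent \<open>|F|\<close>.
\<close>
lemma card_indep_le_card_spans:
  assumes I: "subgroup I G" and Y: "finite Y" "Y \<subseteq> carrier G"
    and E: "indep_mod G I E" "E \<subseteq> int_span G Y" and F: "spans_mod G I F Y"
  shows "card E \<le> card F"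
proof -
  obtain C where C: "C > 0" "\<And>k. (k + 1) ^ card E \<le> card ((#>) I ` comb_ball G Y (C * k))"
    using coset_count_lower[OF I Y E] by blast
  obtain D where D: "\<And>k. k \<ge> 1 \<Longrightarrow> card ((#>) I ` comb_ball G Y k) \<le> D * k ^ card F"
    using coset_count_upper[OF I Y F] by blast
  have "(k + 1) ^ card E \<le> (D * C ^ card F) * k ^ card F" if "k \<ge> 1" for k
    using C(2)[of k] D[of "C * k"] C(1) that by (simp add: power_mult_distrib algebra_simps)
  then show ?thesis by (rule exponent_le)
qed

text \<open>
  A maximal independent subset \<open>E\<close> of \<open>Y\<close> works: for \<open>y\<close> outside \<open>E\<close> maximality yields a relation
  modulo \<open>I\<close>, whose coefficient at \<open>y\<close> cannot vanish. The product of the resulting exponents is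
  a common one.
\<close>
lemma ex_maximal_indep:
  assumes I: "subgroup I G" and Y: "finite Y" "Y \<subseteq> carrier G"
  shows "\<exists>E. indep_mod G I E \<and> spans_mod G I E Y"
proof -
  interpret I: subgroup I G by (rule I)
  let ?S = "{E. E \<subseteq> Y \<and> indep_mod G I E}"
  have "finite ?S" "{} \<in> ?S" using Y(1) by (auto simp: indep_mod_def)
  then obtain E where "E \<in> ?S" and max: "\<And>F. F \<in> ?S \<Longrightarrow> E \<subseteq> F \<Longrightarrow> E = F"
    using finite_has_maximal[of ?S] by auto
  then have EY: "E \<subseteq> Y" and E: "indep_mod G I E" by auto
  have Ef: "finite E" "E \<subseteq> carrier G" using E by (auto simp: indep_mod_def)
  have "\<exists>m>0. \<exists>i\<in>I. \<exists>c. y [^] (m::int) = i \<otimes> int_comb G E c" if y: "y \<in> Y" for y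
  proof (cases "y \<in> E")
    case True
    then have "y [^] (1::int) = \<one> \<otimes> int_comb G E (\<lambda>x. if x = y then 1 else 0)"
      using Ef by (simp add: int_comb_single subset_iff)
    then show ?thesis using I.one_closed zero_less_one by blast
  next
    case False
    have yG: "y \<in> carrier G" using y Y by auto
    have "\<not> indep_mod G I (insert y E)" using max[of "insert y E"] False y EY by auto
    then obtain c x where c: "int_comb G (insert y E) c \<in> I" and x: "x \<in> insert y E" "c x \<noteq> 0"
      using Ef yG by (auto simp: indep_mod_def)
    define j where "j = int_comb G (insert y E) c"
    define w where "w = int_comb G E c"
    have j: "j \<in> I" "j \<in> carrier G" using c by (auto simp: j_def)
    have w: "w \<in> carrier G" using Ef by (simp add: w_def)
    have "j = y [^] c y \<otimes> w" using False Ef yG by (simp add: int_comb_insert j_def w_def)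
    then have yc: "y [^] c y = j \<otimes> inv w" using yG w by (simp add: m_assoc)
    have "c y \<noteq> 0"
    proof
      assume "c y = 0"
      then have "w \<in> I" using \<open>j = y [^] c y \<otimes> w\<close> j w by simp
      then have "\<forall>e\<in>E. c e = 0" using E by (auto simp: indep_mod_def w_def)
      then show False using x \<open>c y = 0\<close> by auto
    qed
    then consider "c y > 0" | "- c y > 0" by linarith
    then show ?thesis
    proof cases
      case 1
      have "y [^] c y = j \<otimes> int_comb G E (\<lambda>e. - c e)"
        using yc Ef by (simp add: int_comb_minus w_def)
      then show ?thesis using 1 j by blast
    next
      case 2
      have "y [^] (- c y) = inv j \<otimes> w"
        using yc yG j w by (simp add: int_pow_neg inv_mult)
      then show ?thesis using 2 j I.m_inv_closed unfolding w_def by blast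
    qed
  qed
  then obtain m where m: "\<And>y. y \<in> Y \<Longrightarrow> m y > 0"
    and "\<And>y. y \<in> Y \<Longrightarrow> \<exists>i\<in>I. \<exists>c. y [^] (m y :: int) = i \<otimes> int_comb G E c"
    by metis
  then obtain i c where i: "\<And>y. y \<in> Y \<Longrightarrow> i y \<in> I"
    and ic: "\<And>y. y \<in> Y \<Longrightarrow> y [^] m y = i y \<otimes> int_comb G E (c y)"
    by metis
  define M where "M = prod m Y"
  have "\<exists>j\<in>I. \<exists>d. y [^] M = j \<otimes> int_comb G E d" if y: "y \<in> Y" for y
  proof -
    define n where "n = prod m (Y - {y})"
    have "M = m y * n" using Y y by (simp add: M_def n_def prod.remove)
    then have "y [^] M = (y [^] m y) [^] n" using Y y by (simp add: int_pow_pow subset_iff)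
    also have "\<dots> = i y [^] n \<otimes> int_comb G E (\<lambda>e. n * c y e)"
      using ic[OF y] i[OF y] Ef by (simp add: int_pow_distrib int_comb_scale)
    finally show ?thesis using subgroup_int_pow_closed[OF I i[OF y]] by blast
  qed
  moreover have "M > 0" using m by (auto simp: M_def intro: prod_pos)
  ultimately have "spans_mod G I E Y" using Ef by (auto simp: spans_mod_def)
  then show ?thesis using E by blast
qed

text \<open>
  The union of \<open>E\<close> and the basis \<open>F\<close> of the subgroup is independent and spans rationally, just as
  \<open>B\<close> does; the Steinitz inequality in both directions gives the equality.
\<close>
lemma rank_additive:
  assumes Y: "finite Y" "Y \<subseteq> carrier G" "int_span G Y = carrier G"
    and B: "indep_mod G {\<one>} B" "int_span G B = carrier G"
    and F: "indep_mod G {\<one>} F"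
    and E: "indep_mod G (int_span G F) E" "spans_mod G (int_span G F) E Y"
  shows "card E + card F = card B"
proof -
  let ?I = "int_span G F"
  have fin: "finite B" "B \<subseteq> carrier G" "finite F" "F \<subseteq> carrier G" "finite E" "E \<subseteq> carrier G"
    using B F E by (auto simp: indep_mod_def)
  have I: "subgroup ?I G" using fin by (intro subgroup_int_span)
  have one: "subgroup {\<one>} G" by (rule triv_subgroup)
  have FI: "F \<subseteq> ?I" using fin by (intro int_span_superset)
  have disj: "E \<inter> F = {}"
  proof (rule ccontr)
    assume "E \<inter> F \<noteq> {}"
    then obtain e where e: "e \<in> E" "e \<in> F" by auto
    have "int_comb G E (\<lambda>x. if x = e then 1 else 0) \<in> ?I"
      unfolding int_comb_single[OF fin(5) e(1) fin(6)] using e FI fin(4) by (auto simp: subset_iff)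
    then have "\<forall>x\<in>E. (if x = e then 1 else 0::int) = 0"
      using E(1) unfolding indep_mod_def by blast
    then show False using e by auto
  qed
  have indep: "indep_mod G {\<one>} (E \<union> F)"
    unfolding indep_mod_def
  proof (intro conjI allI impI)
    fix c assume "int_comb G (E \<union> F) c \<in> {\<one>}"
    then have eq: "int_comb G E c \<otimes> int_comb G F c = \<one>"
      using fin disj by (simp add: int_comb_Un)
    then have "int_comb G E c = inv (int_comb G F c)"
      using fin by (metis inv_equality int_comb_closed)
    then have "int_comb G E c \<in> ?I"
      using I by (simp add: subgroup.m_inv_closed int_span_def)
    then have cE: "\<forall>e\<in>E. c e = 0" using E(1) by (auto simp: indep_mod_def)
    then have "int_comb G E c = \<one>" using fin by (intro int_comb_zero) auto
    then have "int_comb G F c = \<one>" using eq fin by simp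
    then have "\<forall>e\<in>F. c e = 0" using F by (auto simp: indep_mod_def)
    then show "\<forall>e\<in>E \<union> F. c e = 0" using cE by auto
  qed (use fin in auto)
  have spans: "spans_mod G {\<one>} (E \<union> F) Y"
  proof -
    obtain M where M: "M > 0"
      and E': "\<forall>y\<in>Y. \<exists>i\<in>?I. \<exists>c. y [^] (M::int) = i \<otimes> int_comb G E c"
      using E(2) by (auto simp: spans_mod_def)
    have "\<exists>i\<in>{\<one>}. \<exists>c. y [^] M = i \<otimes> int_comb G (E \<union> F) c" if y: "y \<in> Y" for y
    proof -
      obtain d c where dc: "y [^] M = int_comb G F d \<otimes> int_comb G E c"
        using bspec[OF E' y] by (auto simp: int_span_def)
      let ?c = "\<lambda>x. if x \<in> E then c x else d x"
      have "int_comb G E ?c = int_comb G E c" using fin by (intro int_comb_cong) auto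
      moreover have "int_comb G F ?c = int_comb G F d"
        using fin disj by (intro int_comb_cong) auto
      ultimately have "y [^] M = \<one> \<otimes> int_comb G (E \<union> F) ?c"
        using dc fin disj by (simp add: int_comb_Un m_comm)
      then show ?thesis by blast
    qed
    then show ?thesis using M fin by (auto simp: spans_mod_def)
  qed
  have "spans_mod G {\<one>} B B"
  proof -
    have "\<exists>c. b [^] (1::int) = \<one> \<otimes> int_comb G B c" if "b \<in> B" for b
      using int_comb_single[OF fin(1) that fin(2), of 1] fin that
      by (intro exI[of _ "\<lambda>x. if x = b then 1 else 0"]) auto
    then show ?thesis using fin unfolding spans_mod_def by (metis insertI1 zero_less_one)
  qed
  then have "card (E \<union> F) \<le> card B"
    using card_indep_le_card_spans[OF one fin(1,2) indep] fin B(2) by auto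
  moreover have "card B \<le> card (E \<union> F)"
    using card_indep_le_card_spans[OF one Y(1,2) B(1) _ spans] fin Y(3) by auto
  moreover have "card (E \<union> F) = card E + card F"
    using fin disj by (intro card_Un_disjoint)
  ultimately show ?thesis by simp
qed

lemma hom_image_int_span:
  assumes h: "h \<in> hom G G" and Y: "finite Y" "Y \<subseteq> carrier G"
  shows "h ` int_span G Y = int_span G (h ` Y)"
proof
  interpret h: group_hom G G h by unfold_locales (rule h)
  have hY: "finite (h ` Y)" "h ` Y \<subseteq> carrier G" using Y by auto
  interpret S: subgroup "int_span G (h ` Y)" G using hY(2) by (rule subgroup_int_span)
  have "subgroup {x \<in> carrier G. h x \<in> int_span G (h ` Y)} G"
    by unfold_locales auto
  moreover have "Y \<subseteq> {x \<in> carrier G. h x \<in> int_span G (h ` Y)}"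
    using int_span_superset[OF hY] Y by auto
  ultimately show "h ` int_span G Y \<subseteq> int_span G (h ` Y)"
    using int_span_minimal by blast
  have "subgroup (h ` int_span G Y) G"
    using Y by (intro h.subgroup_img_is_subgroup subgroup_int_span)
  then show "int_span G (h ` Y) \<subseteq> h ` int_span G Y"
    using int_span_superset[OF Y] by (intro int_span_minimal) auto
qed

text \<open>
  Giving \<open>I\<close> by generators \<open>Z\<close> covers the images of endomorphisms and yields a basis of \<open>I\<close>
  from torsion-freeness alone, without the theorem that subgroups of free abelian groups are free.
\<close>
lemma coset_growth:
  assumes tf: "torsion_free G"
    and Y: "finite Y" "Y \<subseteq> carrier G" "int_span G Y = carrier G"
    and Z: "finite Z" "Z \<subseteq> carrier G" and I: "I = int_span G Z"
  shows "free_rank (G\<lparr>carrier := I\<rparr>) \<le> free_rank G"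
    and "\<exists>C>0. \<forall>k. (k + 1) ^ (free_rank G - free_rank (G\<lparr>carrier := I\<rparr>))
           \<le> card ((#>) I ` comb_ball G Y (C * k))"
    and "\<exists>D. \<forall>k\<ge>1. card ((#>) I ` comb_ball G Y k)
           \<le> D * k ^ (free_rank G - free_rank (G\<lparr>carrier := I\<rparr>))"
proof -
  have sub: "subgroup I G" unfolding I using Z(2) by (rule subgroup_int_span)
  obtain B where B: "indep_mod G {\<one>} B" "int_span G B = carrier G"
    using ex_basis[OF tf, of Y] Y by auto
  obtain F where F: "indep_mod G {\<one>} F" "int_span G F = I"
    using ex_basis[OF tf, of Z] Z I by auto
  obtain E where E: "indep_mod G I E" "spans_mod G I E Y"
    using ex_maximal_indep[OF sub Y(1,2)] by blast
  have "card E + card F = card B"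
    using E by (intro rank_additive[OF Y B F(1)]) (auto simp: F(2))
  moreover have rB: "free_rank G = card B" using free_rank_int_span[OF B(1)] B(2) by simp
  moreover have rF: "free_rank (G\<lparr>carrier := I\<rparr>) = card F"
    using free_rank_int_span[OF F(1)] F(2) by simp
  ultimately have d: "free_rank G - free_rank (G\<lparr>carrier := I\<rparr>) = card E"
    and "free_rank (G\<lparr>carrier := I\<rparr>) \<le> free_rank G" by auto
  then show "free_rank (G\<lparr>carrier := I\<rparr>) \<le> free_rank G" by simp
  have "E \<subseteq> int_span G Y" using E(1) Y(3) by (auto simp: indep_mod_def)
  then show "\<exists>C>0. \<forall>k. (k + 1) ^ (free_rank G - free_rank (G\<lparr>carrier := I\<rparr>))
           \<le> card ((#>) I ` comb_ball G Y (C * k))"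
    unfolding d by (rule coset_count_lower[OF sub Y(1,2) E(1)])
  show "\<exists>D. \<forall>k\<ge>1. card ((#>) I ` comb_ball G Y k)
           \<le> D * k ^ (free_rank G - free_rank (G\<lparr>carrier := I\<rparr>))"
    unfolding d by (rule coset_count_upper[OF sub Y(1,2) E(2)])
qed

end

section \<open>Word length\<close>

context group
begin

lemma word_prod_closed: "set ws \<subseteq> carrier G \<Longrightarrow> foldr (\<otimes>) ws \<one> \<in> carrier G"
  by (induction ws) auto

lemma word_prod_append:
  "set us \<subseteq> carrier G \<Longrightarrow> set ws \<subseteq> carrier G \<Longrightarrow>
     foldr (\<otimes>) (us @ ws) \<one> = foldr (\<otimes>) us \<one> \<otimes> foldr (\<otimes>) ws \<one>"
  by (induction us) (auto simp: m_assoc word_prod_closed simp del: foldr_append)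

lemma word_prod_inv:
  "set ws \<subseteq> carrier G \<Longrightarrow>
     inv (foldr (\<otimes>) ws \<one>) = foldr (\<otimes>) (rev (map (m_inv G) ws)) \<one>"
proof (induction ws)
  case (Cons w ws)
  have "foldr (\<otimes>) (rev (map (m_inv G) ws) @ [inv w]) \<one>
        = foldr (\<otimes>) (rev (map (m_inv G) ws)) \<one> \<otimes> foldr (\<otimes>) [inv w] \<one>"
    using Cons.prems by (intro word_prod_append) auto
  then show ?case
    using Cons by (simp add: inv_mult_group word_prod_closed del: foldr_append)
qed simp

lemma word_length_le:
  "set ws \<subseteq> S \<union> m_inv G ` S \<Longrightarrow> word_length G S (foldr (\<otimes>) ws \<one>) \<le> length ws"
  unfolding word_length_def by (rule Least_le) auto

end

locale generated_group = group +
  fixes S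
  assumes S_carrier: "S \<subseteq> carrier G" and S_generates: "generate G S = carrier G"
begin

abbreviation "letters \<equiv> S \<union> m_inv G ` S"

lemma letters_carrier: "letters \<subseteq> carrier G"
  using S_carrier by auto

lemma word_carrier: "set ws \<subseteq> letters \<Longrightarrow> set ws \<subseteq> carrier G"
  using letters_carrier by (rule subset_trans[rotated])

lemma ex_word:
  assumes "g \<in> carrier G"
  shows "\<exists>ws. set ws \<subseteq> letters \<and> g = foldr (\<otimes>) ws \<one>"
proof -
  have "g \<in> generate G S" using assms S_generates by simp
  then show ?thesis
  proof induction
    case one
    then show ?case by (intro exI[of _ "[]"]) auto
  next
    case (incl h)
    then show ?case using S_carrier by (intro exI[of _ "[h]"]) auto
  next
    case (inv h)
    then show ?case using S_carrier by (intro exI[of _ "[inv h]"]) auto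
  next
    case (eng h k)
    then obtain us ws where "set us \<subseteq> letters" "h = foldr (\<otimes>) us \<one>"
      "set ws \<subseteq> letters" "k = foldr (\<otimes>) ws \<one>" by blast
    then show ?case
      using word_prod_append[OF word_carrier word_carrier, of us ws]
      by (intro exI[of _ "us @ ws"]) (auto simp del: foldr_append)
  qed
qed

lemma word_length_attained:
  assumes "g \<in> carrier G"
  obtains ws where "set ws \<subseteq> letters" "g = foldr (\<otimes>) ws \<one>" "length ws = word_length G S g"
proof -
  have "\<exists>k ws. length ws = k \<and> set ws \<subseteq> letters \<and> g = foldr (\<otimes>) ws \<one>"
    using ex_word[OF assms] by auto
  from LeastI_ex[OF this] that show ?thesis unfolding word_length_def by blast
qed

lemma word_length_one: "word_length G S \<one> = 0"
  using word_length_le[of "[]" S] by simp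

lemma word_length_mult:
  assumes "g \<in> carrier G" "h \<in> carrier G"
  shows "word_length G S (g \<otimes> h) \<le> word_length G S g + word_length G S h"
proof -
  obtain us where us: "set us \<subseteq> letters" "g = foldr (\<otimes>) us \<one>" "length us = word_length G S g"
    using word_length_attained assms by blast
  obtain ws where ws: "set ws \<subseteq> letters" "h = foldr (\<otimes>) ws \<one>" "length ws = word_length G S h"
    using word_length_attained assms by blast
  have "g \<otimes> h = foldr (\<otimes>) (us @ ws) \<one>"
    using us ws word_prod_append[OF word_carrier word_carrier, of us ws] by simp
  then show ?thesis using word_length_le[of "us @ ws" S] us ws by simp
qed

lemma word_length_inv_le:
  assumes "g \<in> carrier G"
  shows "word_length G S (inv g) \<le> word_length G S g"
proof -
  obtain ws where ws: "set ws \<subseteq> letters" "g = foldr (\<otimes>) ws \<one>" "length ws = word_length G S g"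
    using word_length_attained assms by blast
  have "inv s \<in> letters" if s: "s \<in> letters" for s using s S_carrier by auto
  then have "set (rev (map (m_inv G) ws)) \<subseteq> letters" using ws(1) unfolding set_rev set_map by blast
  moreover have "inv g = foldr (\<otimes>) (rev (map (m_inv G) ws)) \<one>"
    unfolding ws(2) by (rule word_prod_inv[OF word_carrier[OF ws(1)]])
  ultimately show ?thesis using word_length_le[of "rev (map (m_inv G) ws)" S] ws by simp
qed

lemma word_length_nat_pow:
  "g \<in> carrier G \<Longrightarrow> word_length G S (g [^] (n::nat)) \<le> n * word_length G S g"
proof (induction n)
  case (Suc n)
  then show ?case using word_length_mult[of "g [^] n" g] by simp
qed (simp add: word_length_one)

lemma word_length_int_pow:
  assumes "g \<in> carrier G"
  shows "word_length G S (g [^] (n::int)) \<le> nat \<bar>n\<bar> * word_length G S g"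
proof (cases "n \<ge> 0")
  case True
  then have "g [^] n = g [^] nat n" by (subst int_pow_def2) auto
  moreover have "nat \<bar>n\<bar> = nat n" using True by simp
  ultimately show ?thesis using word_length_nat_pow[OF assms, of "nat n"] by simp
next
  case False
  then have "g [^] n = inv (g [^] nat (- n))" by (subst int_pow_def2) auto
  moreover have "word_length G S (inv (g [^] nat (- n))) \<le> word_length G S (g [^] nat (- n))"
    using assms by (intro word_length_inv_le) simp
  moreover have "\<dots> \<le> nat (- n) * word_length G S g" by (rule word_length_nat_pow[OF assms])
  moreover have "nat \<bar>n\<bar> = nat (- n)" using False by simp
  ultimately show ?thesis by simp
qed

end

section \<open>Schreier rewriting for an abelian normal subgroup of finite index\<close>

locale abelian_by_finite = generated_group G S + normal N G for G (structure) and S N +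
  assumes finite_S: "finite S" and comm_N: "comm_group (G\<lparr>carrier := N\<rparr>)"
    and finite_index: "finite (rcosets N)"
begin

abbreviation "A \<equiv> G\<lparr>carrier := N\<rparr>"

sublocale A: comm_group A by (rule comm_N)

lemma N_subgroup: "subgroup N G" ..

lemma N_carrier: "x \<in> N \<Longrightarrow> x \<in> carrier G"
  using subset by blast

text \<open>
  Coset representatives, with the trivial coset represented by \<open>\<one>\<close>: this makes a word for an
  element of \<open>N\<close> rewrite to Schreier generators with nothing left over.
\<close>
definition transv :: "'a \<Rightarrow> 'a" where
  "transv g = (if N #> g = N then \<one> else SOME h. h \<in> N #> g)"

lemma transv_in: "g \<in> carrier G \<Longrightarrow> transv g \<in> N #> g"
  unfolding transv_def using rcos_self[OF _ N_subgroup] someI[of "\<lambda>h. h \<in> N #> g" g] by auto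

lemma transv_closed: "g \<in> carrier G \<Longrightarrow> transv g \<in> carrier G"
  using transv_in r_coset_subset_G[OF subset] by blast

lemma transv_coset: "g \<in> carrier G \<Longrightarrow> N #> transv g = N #> g"
  using repr_independence[OF transv_in _ N_subgroup] by simp

lemma transv_cong: "N #> g = N #> h \<Longrightarrow> transv g = transv h"
  by (simp add: transv_def)

lemma transv_N: "g \<in> N \<Longrightarrow> transv g = \<one>"
  using coset_join2[OF N_carrier N_subgroup] by (simp add: transv_def)

lemma transv_quotient: "g \<in> carrier G \<Longrightarrow> g \<otimes> inv (transv g) \<in> N"
  using rcos_eq_iff[OF N_subgroup _ transv_closed] transv_coset by blast

lemma transv_mult_left:
  assumes "g \<in> carrier G" "h \<in> carrier G"
  shows "transv (transv g \<otimes> h) = transv (g \<otimes> h)"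
  using assms coset_mult_assoc[OF subset] transv_closed transv_coset
  by (intro transv_cong) metis

definition transversal :: "'a set" where
  "transversal = transv ` carrier G"

lemma transversal_carrier: "t \<in> transversal \<Longrightarrow> t \<in> carrier G"
  using transv_closed by (auto simp: transversal_def)

lemma transv_transversal: "t \<in> transversal \<Longrightarrow> transv t = t"
  using transv_coset by (auto simp: transversal_def intro: transv_cong)

lemma finite_transversal: "finite transversal"
proof (rule finite_subset)
  show "transversal \<subseteq> (\<lambda>C. if C = N then \<one> else SOME h. h \<in> C) ` (rcosets N)"
    by (auto simp: transversal_def transv_def RCOSETS_def)
  show "finite ((\<lambda>C. if C = N then \<one> else SOME h. h \<in> C) ` (rcosets N))"
    using finite_index by simp
qed

definition schreier_gens :: "'a set" where
  "schreier_gens = (\<lambda>(t, s). t \<otimes> s \<otimes> inv (transv (t \<otimes> s))) ` (transversal \<times> letters)"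

lemma finite_schreier_gens: "finite schreier_gens"
  unfolding schreier_gens_def using finite_transversal finite_S by auto

lemma schreier_gens_N: "schreier_gens \<subseteq> N"
  unfolding schreier_gens_def using transversal_carrier letters_carrier
  by (auto intro!: transv_quotient)

lemma schreier_gens_A: "schreier_gens \<subseteq> carrier A"
  using schreier_gens_N by simp

text \<open>
  Reading a word from the left, \<open>t s = (t s u\<^sup>-\<^sup>1) u\<close> with \<open>u\<close> the representative of \<open>t s\<close>: each letter
  splits off one Schreier generator on the left and leaves a representative to be multiplied with
  the rest of the word. The starting representative \<open>t\<close> is therefore arbitrary.
\<close>
lemma schreier_rewriting:
  assumes "set ws \<subseteq> letters" "t \<in> transversal"
  shows "\<exists>x\<in>comb_ball A schreier_gens (length ws).
           t \<otimes> foldr (\<otimes>) ws \<one> = x \<otimes> transv (t \<otimes> foldr (\<otimes>) ws \<one>)"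
  using assms
proof (induction ws arbitrary: t)
  case Nil
  then show ?case
    using A.one_in_comb_ball[OF schreier_gens_A, of 0] transversal_carrier transv_transversal
    by (intro bexI[of _ \<one>]) auto
next
  case (Cons s ws)
  define w where "w = foldr (\<otimes>) ws \<one>"
  define u where "u = transv (t \<otimes> s)"
  have sG: "s \<in> carrier G" and tG: "t \<in> carrier G" and wG: "w \<in> carrier G"
    using Cons.prems letters_carrier transversal_carrier word_prod_closed[OF word_carrier, of ws]
    by (auto simp: w_def)
  have uT: "u \<in> transversal" using sG tG by (auto simp: u_def transversal_def)
  then have uG: "u \<in> carrier G" by (rule transversal_carrier)
  obtain x where x: "x \<in> comb_ball A schreier_gens (length ws)"
    and xw: "u \<otimes> w = x \<otimes> transv (u \<otimes> w)"
    using Cons.IH[OF _ uT] Cons.prems by (auto simp: w_def)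
  have xN: "x \<in> N" using x A.comb_ball_subset[OF schreier_gens_A] by auto
  define y where "y = t \<otimes> s \<otimes> inv u"
  have y: "y \<in> schreier_gens" unfolding y_def u_def schreier_gens_def
    using Cons.prems by (intro image_eqI[of _ _ "(t, s)"]) auto
  then have yN: "y \<in> N" using schreier_gens_N by auto
  have "y \<in> comb_ball A schreier_gens 1"
  proof -
    have "int_comb A schreier_gens (\<lambda>x. if x = y then 1 else 0) = y"
      using A.int_comb_single[OF finite_schreier_gens y schreier_gens_A, of 1] yN by simp
    moreover have "(\<Sum>x\<in>schreier_gens. \<bar>if x = y then 1 else 0\<bar>) = (1::int)"
      using y finite_schreier_gens by (simp add: if_distrib[of abs] cong: if_cong)
    ultimately show ?thesis unfolding comb_ball_def
      by (intro CollectI exI[of _ "\<lambda>x. if x = y then 1 else 0"]) simp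
  qed
  then have yx: "y \<otimes> x \<in> comb_ball A schreier_gens (length (s # ws))"
    using A.comb_ball_mult[OF schreier_gens_A _ x, of y 1] by simp
  have "t \<otimes> (s \<otimes> w) = y \<otimes> (u \<otimes> w)"
    using sG tG wG uG by (simp add: y_def m_assoc inv_solve_left)
  also have "\<dots> = (y \<otimes> x) \<otimes> transv (u \<otimes> w)"
    using xw uG wG xN yN transv_closed[of "u \<otimes> w"] by (simp add: m_assoc N_carrier)
  also have "transv (u \<otimes> w) = transv (t \<otimes> (s \<otimes> w))"
    using sG tG wG by (simp add: u_def transv_mult_left m_assoc)
  finally show ?case using yx by (auto simp: w_def)
qed

lemma schreier_decomposition:
  assumes "g \<in> carrier G"
  shows "\<exists>x\<in>comb_ball A schreier_gens (word_length G S g). g = x \<otimes> transv g"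
proof -
  obtain ws where ws: "set ws \<subseteq> letters" "g = foldr (\<otimes>) ws \<one>" "length ws = word_length G S g"
    using word_length_attained assms by blast
  have "\<one> \<in> transversal"
    using transv_N[OF one_closed] unfolding transversal_def
    by (metis group.is_monoid group_axioms image_eqI monoid.one_closed)
  from schreier_rewriting[OF ws(1) this] show ?thesis
    using assms ws by simp
qed

lemma int_span_schreier_gens: "int_span A schreier_gens = N"
proof
  show "int_span A schreier_gens \<subseteq> N"
    using A.subgroup_int_span[OF schreier_gens_A] subgroup.subset by fastforce
  show "N \<subseteq> int_span A schreier_gens"
  proof
    fix g assume g: "g \<in> N"
    then obtain x where "x \<in> comb_ball A schreier_gens (word_length G S g)" "g = x \<otimes> transv g"
      using schreier_decomposition N_carrier by blast
    moreover from this have "x \<in> N" using A.comb_ball_subset[OF schreier_gens_A] by auto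
    ultimately show "g \<in> int_span A schreier_gens"
      using g by (auto simp: transv_N comb_ball_def int_span_def N_carrier)
  qed
qed

text \<open>
  The converse comparison of the two metrics: a combination is a product of boundedly long pieces.
\<close>
lemma comb_ball_word_length:
  "\<exists>C>0. \<forall>k. \<forall>x\<in>comb_ball A schreier_gens k. word_length G S x \<le> C * k"
proof -
  have le: "word_length G S (int_comb A Y c) \<le> (\<Sum>y\<in>Y. nat \<bar>c y\<bar> * word_length G S y)"
    if "finite Y" "Y \<subseteq> N" for Y c
    using that
  proof (induction Y)
    case empty
    then show ?case using A.int_comb_empty[of c] by (simp add: word_length_one)
  next
    case (insert y Y)
    have "int_comb A (insert y Y) c = y [^] c y \<otimes> int_comb A Y c"
      using insert A.int_comb_insert[of Y y c] int_pow_consistent[OF N_subgroup] by simp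
    moreover have "y [^] c y \<in> carrier G" "int_comb A Y c \<in> carrier G"
      using insert A.int_comb_closed[of Y c] N_carrier by auto
    ultimately show ?case
      using insert word_length_mult[of "y [^] c y" "int_comb A Y c"]
        word_length_int_pow[of y "c y"] N_carrier by auto
  qed
  define C where "C = (\<Sum>y\<in>schreier_gens. word_length G S y) + 1"
  have "word_length G S x \<le> C * k" if xk: "x \<in> comb_ball A schreier_gens k" for x k
  proof -
    obtain c where x: "x = int_comb A schreier_gens c"
      and c: "(\<Sum>y\<in>schreier_gens. \<bar>c y\<bar>) \<le> int k"
      using xk by (auto simp: comb_ball_def)
    have "word_length G S x \<le> (\<Sum>y\<in>schreier_gens. nat \<bar>c y\<bar> * word_length G S y)"
      unfolding x using finite_schreier_gens schreier_gens_N by (rule le)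
    also have "\<dots> \<le> (\<Sum>y\<in>schreier_gens. nat \<bar>c y\<bar> * C)"
    proof (intro sum_mono mult_left_mono)
      fix y assume "y \<in> schreier_gens"
      then show "word_length G S y \<le> C"
        unfolding C_def using finite_schreier_gens
        by (intro trans_le_add1 member_le_sum) auto
    qed simp
    also have "\<dots> = C * (\<Sum>y\<in>schreier_gens. nat \<bar>c y\<bar>)"
      by (simp add: sum_distrib_left mult.commute)
    also have "(\<Sum>y\<in>schreier_gens. nat \<bar>c y\<bar>) \<le> k"
    proof -
      have "int (\<Sum>y\<in>schreier_gens. nat \<bar>c y\<bar>) = (\<Sum>y\<in>schreier_gens. \<bar>c y\<bar>)" by simp
      then show ?thesis using c by linarith
    qed
    finally show ?thesis by simp
  qed
  then show ?thesis by (intro exI[of _ C]) (auto simp: C_def)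
qed

end

section \<open>From integer radii to asymptotics\<close>

text \<open>
  The dilation \<open>C\<close> accounts for comparing two word metrics; rounding \<open>r\<close> up and \<open>r / C\<close> down to
  integers costs only constant factors.
\<close>
lemma bigtheta_powerI:
  fixes F :: "real \<Rightarrow> nat"
  assumes mono: "\<And>r s. r \<le> s \<Longrightarrow> F r \<le> F s"
    and upper: "\<And>k::nat. k \<ge> 1 \<Longrightarrow> F (real k) \<le> D * k ^ d"
    and C: "C > 0" and lower: "\<And>k::nat. k \<ge> 1 \<Longrightarrow> (k + 1) ^ d \<le> c * F (real (C * k))"
  shows "(\<lambda>r. real (F r)) \<in> \<Theta>(\<lambda>r. r ^ d)"
proof (rule bigthetaI)
  show "(\<lambda>r. real (F r)) \<in> O(\<lambda>r. r ^ d)"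
  proof (rule bigoI)
    show "\<forall>\<^sub>F r in at_top. norm (real (F r)) \<le> (real D * 2 ^ d) * norm (r ^ d)"
      using eventually_ge_at_top[of 1]
    proof eventually_elim
      fix r :: real assume r: "1 \<le> r"
      define k where "k = nat \<lceil>r\<rceil>"
      have k: "r \<le> real k" "k \<ge> 1" "real k \<le> 2 * r" unfolding k_def using r by linarith+
      have "real (F r) \<le> real (F (real k))" using mono[OF k(1)] by simp
      also have "\<dots> \<le> real (D * k ^ d)" using upper[OF k(2)] of_nat_le_iff by blast
      also have "\<dots> = real D * real k ^ d" by simp
      also have "\<dots> \<le> real D * (2 * r) ^ d" using k by (intro mult_left_mono power_mono) auto
      finally show "norm (real (F r)) \<le> (real D * 2 ^ d) * norm (r ^ d)"
        using r by (simp add: power_mult_distrib mult.assoc)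
    qed
  qed
  show "(\<lambda>r. real (F r)) \<in> \<Omega>(\<lambda>r. r ^ d)"
    unfolding bigomega_iff_bigo
  proof (rule bigoI)
    show "\<forall>\<^sub>F r in at_top. norm (r ^ d) \<le> (real C ^ d * real c) * norm (real (F r))"
      using eventually_ge_at_top[of "real C"]
    proof eventually_elim
      fix r :: real assume r: "real C \<le> r"
      define k where "k = nat \<lfloor>r / real C\<rfloor>"
      have q: "r / real C \<ge> 1" using r C by simp
      have k: "k \<ge> 1" "real k \<le> r / real C" "r / real C \<le> real (k + 1)"
        unfolding k_def using q by linarith+
      have Ck: "real (C * k) \<le> r" using k(2) C by (simp add: field_simps)
      have "(r / real C) ^ d \<le> real (k + 1) ^ d" using k q by (intro power_mono) auto
      also have "\<dots> = real ((k + 1) ^ d)" by simp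
      also have "\<dots> \<le> real (c * F (real (C * k)))" using lower[OF k(1)] of_nat_le_iff by blast
      also have "\<dots> = real c * real (F (real (C * k)))" by simp
      also have "\<dots> \<le> real c * real (F r)" using mono[OF Ck] by (intro mult_left_mono) auto
      finally have "(r / real C) ^ d \<le> real c * real (F r)" .
      then have "real C ^ d * (r / real C) ^ d \<le> real C ^ d * (real c * real (F r))"
        by (intro mult_left_mono) auto
      then show "norm (r ^ d) \<le> (real C ^ d * real c) * norm (real (F r))"
        using C r by (simp add: power_divide mult.assoc)
    qed
  qed
qed

section \<open>Growth of the group\<close>

context abelian_by_finite
begin

lemma word_ball_subset:
  "word_ball G S (real k) \<subseteq> (\<lambda>(x, t). x \<otimes> t) ` (comb_ball A schreier_gens k \<times> transversal)"
proof
  fix g assume "g \<in> word_ball G S (real k)"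
  then have g: "g \<in> carrier G" "word_length G S g \<le> k" by (auto simp: word_ball_def)
  obtain x where "x \<in> comb_ball A schreier_gens (word_length G S g)" "g = x \<otimes> transv g"
    using schreier_decomposition[OF g(1)] by blast
  moreover have "comb_ball A schreier_gens (word_length G S g) \<subseteq> comb_ball A schreier_gens k"
    using g(2) by (rule A.comb_ball_mono)
  ultimately show "g \<in> (\<lambda>(x, t). x \<otimes> t) ` (comb_ball A schreier_gens k \<times> transversal)"
    using g(1) by (intro image_eqI[of _ _ "(x, transv g)"]) (auto simp: transversal_def)
qed

lemma finite_schreier_ball: "finite (comb_ball A schreier_gens k)"
  by (rule A.finite_comb_ball[OF finite_schreier_gens schreier_gens_A])

lemma word_ball_mono: "r \<le> s \<Longrightarrow> word_ball G S r \<subseteq> word_ball G S s"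
  by (auto simp: word_ball_def)

lemma finite_word_ball: "finite (word_ball G S r)"
proof (rule finite_subset)
  show "word_ball G S r \<subseteq> word_ball G S (real (nat \<lceil>r\<rceil>))"
    by (rule word_ball_mono) linarith
  show "finite (word_ball G S (real (nat \<lceil>r\<rceil>)))"
    using finite_subset[OF word_ball_subset] finite_schreier_ball finite_transversal by blast
qed

end

locale torsion_free_by_finite = abelian_by_finite +
  assumes tf: "torsion_free (G\<lparr>carrier := N\<rparr>)"
begin

lemma int_span_schreier_gens_A: "int_span A schreier_gens = carrier A"
  by (simp add: int_span_schreier_gens)

lemmas N_coset_growth =
  A.coset_growth[OF tf finite_schreier_gens schreier_gens_A int_span_schreier_gens_A]

text \<open>
  The case of the trivial subgroup, in which cosets are elements; the finite transversal changes
  the count by a constant factor.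
\<close>
lemma word_ball_growth: "(\<lambda>r. real (card (word_ball G S r))) \<in> \<Theta>(\<lambda>r. r ^ free_rank A)"
proof -
  let ?n = "free_rank A" and ?B = "comb_ball A schreier_gens" and ?I = "int_span A {}"
  have indep: "indep_mod A {\<one>\<^bsub>A\<^esub>} {}" by (simp add: indep_mod_def)
  have rk: "free_rank (A\<lparr>carrier := ?I\<rparr>) = 0"
    using A.free_rank_int_span[OF indep] by simp
  have I: "?I = {\<one>\<^bsub>A\<^esub>}" unfolding int_span_def A.int_comb_empty by auto
  have card: "card ((#>\<^bsub>A\<^esub>) ?I ` ?B k) = card (?B k)" for k
  proof (intro card_image inj_onI)
    fix x y assume "x \<in> ?B k" "y \<in> ?B k" and eq: "?I #>\<^bsub>A\<^esub> x = ?I #>\<^bsub>A\<^esub> y"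
    then have "x \<in> carrier A" "y \<in> carrier A"
      using A.comb_ball_subset[OF schreier_gens_A] by blast+
    then show "x = y" using eq by (simp add: I r_coset_def N_carrier)
  qed
  have "\<exists>C>0. \<forall>k. (k + 1) ^ ?n \<le> card (?B (C * k))"
    using N_coset_growth(2)[of "{}" ?I] unfolding rk card diff_zero by blast
  then obtain C where C: "C > 0" "\<And>k. (k + 1) ^ ?n \<le> card (?B (C * k))" by blast
  have "\<exists>D. \<forall>k\<ge>1. card (?B k) \<le> D * k ^ ?n"
    using N_coset_growth(3)[of "{}" ?I] unfolding rk card diff_zero by blast
  then obtain D where D: "\<And>k. k \<ge> 1 \<Longrightarrow> card (?B k) \<le> D * k ^ ?n" by blast
  obtain L where L: "L > 0" "\<And>k x. x \<in> ?B k \<Longrightarrow> word_length G S x \<le> L * k"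
    using comb_ball_word_length by blast
  show ?thesis
  proof (rule bigtheta_powerI)
    show "card (word_ball G S r) \<le> card (word_ball G S s)" if "r \<le> s" for r s
      using that by (intro card_mono finite_word_ball word_ball_mono)
    show "card (word_ball G S (real k)) \<le> (D * card transversal) * k ^ ?n" if "k \<ge> 1" for k
    proof -
      have fin: "finite (?B k \<times> transversal)"
        using finite_schreier_ball finite_transversal by blast
      have "card (word_ball G S (real k)) \<le> card (?B k \<times> transversal)"
        using card_mono[OF finite_imageI[OF fin] word_ball_subset] card_image_le[OF fin]
        by (rule le_trans)
      also have "\<dots> = card (?B k) * card transversal" by (simp add: card_cartesian_product)
      also have "\<dots> \<le> (D * k ^ ?n) * card transversal" using D[OF that] by (rule mult_right_mono) simp
      finally show ?thesis by (simp add: algebra_simps)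
    qed
    show "0 < L * C" using L C by simp
    show "(k + 1) ^ ?n \<le> 1 * card (word_ball G S (real (L * C * k)))" for k
    proof -
      have "?B (C * k) \<subseteq> word_ball G S (real (L * C * k))"
        using L(2)[of _ "C * k"] A.comb_ball_subset[OF schreier_gens_A]
        by (force simp: word_ball_def N_carrier mult.assoc simp flip: of_nat_mult)
      then have "card (?B (C * k)) \<le> card (word_ball G S (real (L * C * k)))"
        by (intro card_mono finite_word_ball)
      then show ?thesis using C(2)[of k] by simp
    qed
  qed
qed

end

section \<open>Twisted conjugacy classes\<close>

lemma card_image_le_factor:
  assumes "finite B" "\<And>x y. x \<in> B \<Longrightarrow> y \<in> B \<Longrightarrow> f x = f y \<Longrightarrow> g x = g y"
  shows "card (g ` B) \<le> card (f ` B)"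
proof -
  have "g ` B = (\<lambda>z. g (inv_into B f z)) ` f ` B"
    unfolding image_image using assms(2)
    by (intro image_cong refl) (metis f_inv_into_f imageI inv_into_into)
  then show ?thesis using assms(1) by (simp add: card_image_le)
qed

lemma card_image_le_fibres:
  assumes "finite B" "\<And>z. z \<in> g ` B \<Longrightarrow> card (f ` {x \<in> B. g x = z}) \<le> m"
  shows "card (f ` B) \<le> m * card (g ` B)"
proof -
  have "f ` B = (\<Union>z\<in>g ` B. f ` {x \<in> B. g x = z})" by auto
  then have "card (f ` B) \<le> (\<Sum>z\<in>g ` B. card (f ` {x \<in> B. g x = z}))"
    using card_UN_le[of "g ` B" "\<lambda>z. f ` {x \<in> B. g x = z}"] assms(1) by simp
  also have "\<dots> \<le> of_nat (card (g ` B)) * m" using assms(2) by (intro sum_bounded_above)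
  finally show ?thesis by (simp add: mult.commute)
qed

context group
begin

lemma twisted_class_eqI:
  assumes \<phi>: "\<phi> \<in> hom G G" and gh: "(g, h) \<in> twisted_conj G \<phi>"
  shows "twisted_class G \<phi> g = twisted_class G \<phi> h"
proof -
  interpret \<phi>: group_hom G G \<phi> by unfold_locales (rule \<phi>)
  have trans: "(a, c) \<in> twisted_conj G \<phi>"
    if abc: "(a, b) \<in> twisted_conj G \<phi>" "(b, c) \<in> twisted_conj G \<phi>" for a b c
  proof -
    obtain z w where *: "z \<in> carrier G" "w \<in> carrier G" "b \<in> carrier G" "c \<in> carrier G"
      "a \<in> carrier G" "a = z \<otimes> b \<otimes> inv (\<phi> z)" "b = w \<otimes> c \<otimes> inv (\<phi> w)"
      using abc by (auto simp: twisted_conj_def)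
    then have "a = (z \<otimes> w) \<otimes> c \<otimes> inv (\<phi> (z \<otimes> w))"
      by (simp add: inv_mult_group m_assoc)
    then show ?thesis using * unfolding twisted_conj_def by blast
  qed
  have sym: "(b, a) \<in> twisted_conj G \<phi>" if ab: "(a, b) \<in> twisted_conj G \<phi>" for a b
  proof -
    obtain z where *: "z \<in> carrier G" "b \<in> carrier G" "a \<in> carrier G" "a = z \<otimes> b \<otimes> inv (\<phi> z)"
      using ab by (auto simp: twisted_conj_def)
    then have "b = inv z \<otimes> a \<otimes> inv (\<phi> (inv z))"
      by (simp add: m_assoc inv_solve_left)
    then show ?thesis using * unfolding twisted_conj_def by blast
  qed
  show ?thesis unfolding twisted_class_def using gh trans sym by blast
qed

lemma twisted_conj_refl:
  assumes \<phi>: "\<phi> \<in> hom G G" and g: "g \<in> carrier G"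
  shows "(g, g) \<in> twisted_conj G \<phi>"
proof -
  interpret \<phi>: group_hom G G \<phi> by unfold_locales (rule \<phi>)
  show ?thesis using g unfolding twisted_conj_def by (auto intro!: bexI[of _ \<one>])
qed

end

locale twisted_by_finite = torsion_free_by_finite +
  fixes \<phi> :: "'a \<Rightarrow> 'a"
  assumes \<phi>_hom: "\<phi> \<in> hom G G" and \<phi>_N: "\<phi> ` N \<subseteq> N"
begin

sublocale \<phi>: group_hom G G \<phi> by unfold_locales (rule \<phi>_hom)

abbreviation twist :: "'a \<Rightarrow> 'a \<Rightarrow> 'a" where
  "twist g \<equiv> endo_diff A id (conjugation G g \<circ> \<phi>)"

lemma conj_N: "g \<in> carrier G \<Longrightarrow> x \<in> N \<Longrightarrow> g \<otimes> \<phi> x \<otimes> inv g \<in> N"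
  using \<phi>_N by (intro inv_op_closed2) auto

lemma twist_eq: "g \<in> carrier G \<Longrightarrow> x \<in> N \<Longrightarrow> twist g x = x \<otimes> inv (g \<otimes> \<phi> x \<otimes> inv g)"
  using m_inv_consistent[OF N_subgroup conj_N] by (simp add: endo_diff_def conjugation_def)

lemma N_comm: "x \<in> N \<Longrightarrow> y \<in> N \<Longrightarrow> x \<otimes> y = y \<otimes> x"
  using A.m_comm by simp

lemma twist_hom:
  assumes g: "g \<in> carrier G"
  shows "twist g \<in> hom A A"
proof (rule homI)
  show "twist g x \<in> carrier A" if "x \<in> carrier A" for x
    using that conj_N[OF g] by (simp add: twist_eq[OF g])
  fix x y assume "x \<in> carrier A" "y \<in> carrier A"
  then have N: "x \<in> N" "y \<in> N" by auto
  let ?c = "\<lambda>x. g \<otimes> \<phi> x \<otimes> inv g"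
  have c: "?c x \<in> N" "?c y \<in> N" using conj_N[OF g] N by auto
  have xy: "?c (x \<otimes> y) = ?c x \<otimes> ?c y"
  proof -
    have "inv g \<otimes> (g \<otimes> (\<phi> y \<otimes> inv g)) = \<phi> y \<otimes> inv g"
      using g N by (simp add: N_carrier flip: m_assoc)
    then show ?thesis using g N by (simp add: m_assoc N_carrier)
  qed
  have "(x \<otimes> y) \<otimes> inv (a \<otimes> b) = (x \<otimes> inv a) \<otimes> (y \<otimes> inv b)" if ab: "a \<in> N" "b \<in> N" for a b
  proof -
    have "(x \<otimes> y) \<otimes> inv (a \<otimes> b) = x \<otimes> ((y \<otimes> inv b) \<otimes> inv a)"
      using N ab by (simp add: inv_mult_group N_carrier m_assoc)
    also have "(y \<otimes> inv b) \<otimes> inv a = inv a \<otimes> (y \<otimes> inv b)"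
      using N ab by (intro N_comm) auto
    finally show ?thesis using N ab by (simp add: N_carrier m_assoc)
  qed
  from this[OF c] have "(x \<otimes> y) \<otimes> inv (?c (x \<otimes> y)) = (x \<otimes> inv (?c x)) \<otimes> (y \<otimes> inv (?c y))"
    unfolding xy .
  then show "twist g (x \<otimes>\<^bsub>A\<^esub> y) = twist g x \<otimes>\<^bsub>A\<^esub> twist g y"
    using N by (simp add: twist_eq[OF g])
qed

abbreviation twist_image :: "'a \<Rightarrow> 'a set" where
  "twist_image g \<equiv> twist g ` carrier A"

abbreviation twist_rank :: "'a \<Rightarrow> nat" where
  "twist_rank g \<equiv> endo_rank A (twist g)"

lemma twist_image_span:
  assumes "g \<in> carrier G"
  shows "twist_image g = int_span A (twist g ` schreier_gens)"
  using A.hom_image_int_span[OF twist_hom[OF assms] finite_schreier_gens schreier_gens_A]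
  unfolding int_span_schreier_gens_A .

lemma twist_gens: "g \<in> carrier G \<Longrightarrow> twist g ` schreier_gens \<subseteq> carrier A"
  using twist_hom schreier_gens_A by (fastforce simp: hom_def)

lemma twist_coset_growth:
  assumes g: "g \<in> carrier G"
  shows "twist_rank g \<le> free_rank A"
    and "\<exists>C>0. \<forall>k. (k + 1) ^ (free_rank A - twist_rank g)
           \<le> card ((#>\<^bsub>A\<^esub>) (twist_image g) ` comb_ball A schreier_gens (C * k))"
    and "\<exists>D. \<forall>k\<ge>1. card ((#>\<^bsub>A\<^esub>) (twist_image g) ` comb_ball A schreier_gens k)
           \<le> D * k ^ (free_rank A - twist_rank g)"
  unfolding endo_rank_def
  by (rule N_coset_growth[OF finite_imageI[OF finite_schreier_gens] twist_gens[OF g]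
        twist_image_span[OF g]])+

lemma twist_subgroup: "g \<in> carrier G \<Longrightarrow> subgroup (twist_image g) A"
  using A.subgroup_int_span[OF twist_gens] twist_image_span by simp

lemma twist_coset_eq_iff:
  assumes "g \<in> carrier G" "x \<in> N" "y \<in> N"
  shows "twist_image g #>\<^bsub>A\<^esub> x = twist_image g #>\<^bsub>A\<^esub> y
    \<longleftrightarrow> (\<exists>n\<in>N. x \<otimes> inv y = n \<otimes> inv (g \<otimes> \<phi> n \<otimes> inv g))"
  using A.rcos_eq_iff[OF twist_subgroup[OF assms(1)]] assms m_inv_consistent[OF N_subgroup assms(3)]
  by (auto simp: twist_eq)

text \<open>
  If \<open>x - y = n - \<tau>\<^sub>g(\<phi> n)\<close>, then \<open>n\<close> itself conjugates \<open>y g\<close> to \<open>x g\<close>, since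
  \<open>g \<phi>(n)\<^sup>-\<^sup>1 = \<tau>\<^sub>g(\<phi> n)\<^sup>-\<^sup>1 g\<close>.
\<close>
lemma twisted_class_cong:
  assumes g: "g \<in> carrier G" and N: "x \<in> N" "y \<in> N"
    and eq: "twist_image g #>\<^bsub>A\<^esub> x = twist_image g #>\<^bsub>A\<^esub> y"
  shows "twisted_class G \<phi> (x \<otimes> g) = twisted_class G \<phi> (y \<otimes> g)"
proof -
  obtain n where n: "n \<in> N" and xy: "x \<otimes> inv y = n \<otimes> inv (g \<otimes> \<phi> n \<otimes> inv g)"
    using eq twist_coset_eq_iff[OF g N] by auto
  let ?c = "g \<otimes> \<phi> n \<otimes> inv g"
  have c: "?c \<in> N" by (rule conj_N[OF g n])
  have "x = (x \<otimes> inv y) \<otimes> y" using N by (simp add: N_carrier m_assoc)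
  then have "x = n \<otimes> inv ?c \<otimes> y" unfolding xy .
  also have "\<dots> = n \<otimes> y \<otimes> inv ?c"
    using N_comm[of "inv ?c" y] N n c by (simp add: N_carrier m_assoc)
  finally have "x \<otimes> g = n \<otimes> (y \<otimes> g) \<otimes> inv (\<phi> n)"
    using g N n by (simp add: N_carrier m_assoc inv_mult_group)
  then have "(x \<otimes> g, y \<otimes> g) \<in> twisted_conj G \<phi>"
    using g N n N_carrier unfolding twisted_conj_def by auto
  then show ?thesis by (rule twisted_class_eqI[OF \<phi>_hom])
qed

text \<open>
  If \<open>z\<close> conjugates \<open>x\<^sub>0 g\<close> to \<open>x g\<close>, write \<open>z = n t\<close> with \<open>n \<in> N\<close> and a representative \<open>t\<close>. The element
  that \<open>t\<close> conjugates \<open>x\<^sub>0 g\<close> to has the form \<open>w g\<close> with \<open>w \<in> N\<close>, and the remaining conjugation by \<open>n\<close>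
  does not change the coset of \<open>w\<close>. So \<open>t\<close> determines the coset of \<open>x\<close>.
\<close>
lemma card_twisted_class_fibre:
  assumes g: "g \<in> carrier G" and B: "B \<subseteq> N" and x0: "x0 \<in> N"
  shows "card ((#>\<^bsub>A\<^esub>) (twist_image g) `
      {x \<in> B. twisted_class G \<phi> (x \<otimes> g) = twisted_class G \<phi> (x0 \<otimes> g)}) \<le> card transversal"
proof -
  let ?h = "x0 \<otimes> g"
  define w where "w t = t \<otimes> ?h \<otimes> inv (\<phi> t) \<otimes> inv g" for t
  have h: "?h \<in> carrier G" using g x0 N_carrier by simp
  have "(#>\<^bsub>A\<^esub>) (twist_image g) ` {x \<in> B. twisted_class G \<phi> (x \<otimes> g) = twisted_class G \<phi> ?h}
        \<subseteq> (\<lambda>t. twist_image g #>\<^bsub>A\<^esub> w t) ` transversal"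
  proof safe
    fix x assume "x \<in> B" and cls: "twisted_class G \<phi> (x \<otimes> g) = twisted_class G \<phi> ?h"
    then have x: "x \<in> N" using B by auto
    have "?h \<in> twisted_class G \<phi> (x \<otimes> g)"
      unfolding cls using twisted_conj_refl[OF \<phi>_hom h] by (auto simp: twisted_class_def)
    then obtain z where z: "z \<in> carrier G" and xg: "x \<otimes> g = z \<otimes> ?h \<otimes> inv (\<phi> z)"
      by (auto simp: twisted_class_def twisted_conj_def)
    define t where "t = transv z"
    define n where "n = z \<otimes> inv t"
    have t: "t \<in> transversal" "t \<in> carrier G" using z by (auto simp: t_def transversal_def transv_closed)
    have n: "n \<in> N" unfolding n_def t_def by (rule transv_quotient[OF z])
    have nG: "n \<in> carrier G" "x \<in> carrier G" using n x N_carrier by auto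
    have znt: "z = n \<otimes> t" using z t by (simp add: n_def m_assoc)
    have wG: "w t \<in> carrier G" using t h g by (simp add: w_def)
    let ?c = "g \<otimes> \<phi> n \<otimes> inv g"
    have c: "?c \<in> N" by (rule conj_N[OF g n])
    have cG: "?c \<in> carrier G" using c N_carrier by auto
    have wg: "w t \<otimes> g = t \<otimes> ?h \<otimes> inv (\<phi> t)"
      using t h g by (simp add: w_def m_assoc)
    have "x \<otimes> g = n \<otimes> (t \<otimes> ?h \<otimes> inv (\<phi> t)) \<otimes> inv (\<phi> n)"
      unfolding xg znt using nG t h by (simp add: inv_mult_group m_assoc)
    also have "\<dots> = n \<otimes> (w t \<otimes> g) \<otimes> inv (\<phi> n)" unfolding wg ..
    also have "\<dots> = (n \<otimes> w t \<otimes> inv ?c) \<otimes> g"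
      using nG wG g by (simp add: inv_mult_group m_assoc)
    finally have xw: "x = n \<otimes> w t \<otimes> inv ?c"
      using nG wG g cG by simp
    have "w t = inv n \<otimes> x \<otimes> ?c"
      unfolding xw using nG(1) wG cG by (simp add: m_assoc inv_solve_left)
    then have wN: "w t \<in> N" using n x c by simp
    have "x = n \<otimes> inv ?c \<otimes> w t"
      unfolding xw using N_comm[of "w t" "inv ?c"] wN c nG wG cG by (simp add: m_assoc)
    then have "x \<otimes> inv (w t) = n \<otimes> inv ?c"
      using nG wG cG by (simp add: m_assoc)
    then have "twist_image g #>\<^bsub>A\<^esub> x = twist_image g #>\<^bsub>A\<^esub> w t"
      using twist_coset_eq_iff[OF g x wN] n by blast
    then show "twist_image g #>\<^bsub>A\<^esub> x \<in> (\<lambda>t. twist_image g #>\<^bsub>A\<^esub> w t) ` transversal"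
      using t(1) by blast
  qed
  then show ?thesis using finite_transversal by (meson surj_card_le)
qed

lemma min_twisted_rank_eq: "min_twisted_rank G N \<phi> = Min (twist_rank ` carrier G)"
proof -
  have "{twist_rank g | C g. C \<in> carrier (G Mod N) \<and> g \<in> C} = twist_rank ` carrier G"
  proof safe
    fix C g assume "C \<in> carrier (G Mod N)" "g \<in> C"
    then show "twist_rank g \<in> twist_rank ` carrier G"
      using rcosets_carrier[OF is_group] by (auto simp: FactGroup_def)
  next
    fix g assume "g \<in> carrier G"
    then show "\<exists>C g'. twist_rank g = twist_rank g' \<and> C \<in> carrier (G Mod N) \<and> g' \<in> C"
      using rcos_self[OF _ N_subgroup, of g]
      by (intro exI[of _ "N #> g"] exI[of _ g]) (auto simp: FactGroup_def RCOSETS_def)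
  qed
  then show ?thesis by (simp add: min_twisted_rank_def)
qed

lemma finite_twist_ranks: "finite (twist_rank ` carrier G)"
  by (rule finite_subset[of _ "{..free_rank A}"]) (use twist_coset_growth(1) in auto)

text \<open>
  For the upper bound all representatives contribute, each with exponent at most
  \<open>rank N - m\<close>; for the lower bound a single \<open>g\<close> that attains the minimum \<open>m\<close> suffices.
\<close>
lemma twisted_growth_bigtheta:
  "(\<lambda>r. real (twisted_growth G S \<phi> r)) \<in> \<Theta>(\<lambda>r. r ^ (free_rank A - min_twisted_rank G N \<phi>))"
proof -
  let ?n = "free_rank A" and ?B = "comb_ball A schreier_gens"
  define m where "m = min_twisted_rank G N \<phi>"
  have m_le: "m \<le> twist_rank g" if "g \<in> carrier G" for g
    unfolding m_def min_twisted_rank_eq using finite_twist_ranks that by simp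
  have "m \<in> twist_rank ` carrier G"
    unfolding m_def min_twisted_rank_eq using finite_twist_ranks one_closed by (intro Min_in) auto
  then obtain g where g: "g \<in> carrier G" and mg: "twist_rank g = m" by auto
  have BN: "?B k \<subseteq> N" for k using A.comb_ball_subset[OF schreier_gens_A] by simp
  have "\<forall>t\<in>transversal. \<exists>D. \<forall>k\<ge>1. card ((#>\<^bsub>A\<^esub>) (twist_image t) ` ?B k) \<le> D * k ^ (?n - twist_rank t)"
    using twist_coset_growth(3) transversal_carrier by blast
  then obtain D where D: "\<And>t k. t \<in> transversal \<Longrightarrow> k \<ge> 1 \<Longrightarrow>
      card ((#>\<^bsub>A\<^esub>) (twist_image t) ` ?B k) \<le> D t * k ^ (?n - twist_rank t)"
    by metis
  obtain C where C: "C > 0" "\<And>k. (k + 1) ^ (?n - m) \<le> card ((#>\<^bsub>A\<^esub>) (twist_image g) ` ?B (C * k))"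
    using twist_coset_growth(2)[OF g] unfolding mg by blast
  obtain L where L: "L > 0" "\<And>k x. x \<in> ?B k \<Longrightarrow> word_length G S x \<le> L * k"
    using comb_ball_word_length by blast
  show ?thesis unfolding m_def[symmetric]
  proof (rule bigtheta_powerI)
    show "twisted_growth G S \<phi> r \<le> twisted_growth G S \<phi> s" if "r \<le> s" for r s
      unfolding twisted_growth_def using that
      by (intro card_mono finite_imageI finite_word_ball image_mono word_ball_mono)
    show "twisted_growth G S \<phi> (real k) \<le> (\<Sum>t\<in>transversal. D t) * k ^ (?n - m)" if k: "k \<ge> 1" for k
    proof -
      have "twisted_class G \<phi> ` word_ball G S (real k)
          \<subseteq> (\<Union>t\<in>transversal. (\<lambda>x. twisted_class G \<phi> (x \<otimes> t)) ` ?B k)"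
      proof
        fix K assume "K \<in> twisted_class G \<phi> ` word_ball G S (real k)"
        then obtain x t where "x \<in> ?B k" "t \<in> transversal" "K = twisted_class G \<phi> (x \<otimes> t)"
          using word_ball_subset[of k] by auto
        then show "K \<in> (\<Union>t\<in>transversal. (\<lambda>x. twisted_class G \<phi> (x \<otimes> t)) ` ?B k)" by blast
      qed
      then have "twisted_growth G S \<phi> (real k)
          \<le> card (\<Union>t\<in>transversal. (\<lambda>x. twisted_class G \<phi> (x \<otimes> t)) ` ?B k)"
        unfolding twisted_growth_def using finite_transversal finite_schreier_ball
        by (intro card_mono) auto
      also have "\<dots> \<le> (\<Sum>t\<in>transversal. card ((\<lambda>x. twisted_class G \<phi> (x \<otimes> t)) ` ?B k))"
        by (rule card_UN_le[OF finite_transversal])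
      also have "\<dots> \<le> (\<Sum>t\<in>transversal. D t * k ^ (?n - m))"
      proof (rule sum_mono)
        fix t assume t: "t \<in> transversal"
        note tG = transversal_carrier[OF t]
        have "card ((\<lambda>x. twisted_class G \<phi> (x \<otimes> t)) ` ?B k)
            \<le> card ((#>\<^bsub>A\<^esub>) (twist_image t) ` ?B k)"
          using BN twisted_class_cong[OF tG]
          by (intro card_image_le_factor finite_schreier_ball) blast
        also have "\<dots> \<le> D t * k ^ (?n - twist_rank t)" by (rule D[OF t k])
        also have "\<dots> \<le> D t * k ^ (?n - m)"
          using m_le[OF tG] k by (intro mult_left_mono power_increasing) auto
        finally show "card ((\<lambda>x. twisted_class G \<phi> (x \<otimes> t)) ` ?B k) \<le> D t * k ^ (?n - m)" .
      qed
      finally show ?thesis by (simp add: sum_distrib_right)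
    qed
    show "0 < L * C + word_length G S g" using L C by simp
    show "(k + 1) ^ (?n - m) \<le> card transversal
        * twisted_growth G S \<phi> (real ((L * C + word_length G S g) * k))" if k: "k \<ge> 1" for k
    proof -
      let ?r = "real ((L * C + word_length G S g) * k)"
      have "x \<otimes> g \<in> word_ball G S ?r" if x: "x \<in> ?B (C * k)" for x
      proof -
        have xG: "x \<in> carrier G" using x BN N_carrier by blast
        have "word_length G S (x \<otimes> g) \<le> L * (C * k) + word_length G S g * 1"
          using word_length_mult[OF xG g] L(2)[OF x] by simp
        also have "\<dots> \<le> L * (C * k) + word_length G S g * k"
          using k by (intro add_left_mono mult_left_mono) auto
        also have "\<dots> = (L * C + word_length G S g) * k" by (simp add: algebra_simps)
        finally have "real (word_length G S (x \<otimes> g)) \<le> ?r" by (simp only: of_nat_le_iff)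
        then show ?thesis using xG g by (simp add: word_ball_def)
      qed
      then have sub: "(\<lambda>x. twisted_class G \<phi> (x \<otimes> g)) ` ?B (C * k) \<subseteq> twisted_class G \<phi> ` word_ball G S ?r"
        by blast
      have "(k + 1) ^ (?n - m) \<le> card ((#>\<^bsub>A\<^esub>) (twist_image g) ` ?B (C * k))" by (rule C(2))
      also have "\<dots> \<le> card transversal * card ((\<lambda>x. twisted_class G \<phi> (x \<otimes> g)) ` ?B (C * k))"
      proof (rule card_image_le_fibres[OF finite_schreier_ball])
        fix K assume "K \<in> (\<lambda>x. twisted_class G \<phi> (x \<otimes> g)) ` ?B (C * k)"
        then obtain x0 where x0: "x0 \<in> N" and K: "K = twisted_class G \<phi> (x0 \<otimes> g)" using BN by blast
        show "card ((#>\<^bsub>A\<^esub>) (twist_image g) ` {x \<in> ?B (C * k). twisted_class G \<phi> (x \<otimes> g) = K})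
            \<le> card transversal"
          unfolding K by (rule card_twisted_class_fibre[OF g BN x0])
      qed
      also have "\<dots> \<le> card transversal * twisted_growth G S \<phi> ?r"
        unfolding twisted_growth_def
        by (intro mult_left_mono card_mono sub finite_imageI finite_word_ball) simp
      finally show ?thesis .
    qed
  qed
qed

lemma min_twisted_rank_le: "min_twisted_rank G N \<phi> \<le> free_rank A"
proof -
  have "min_twisted_rank G N \<phi> \<le> twist_rank \<one>"
    unfolding min_twisted_rank_eq using finite_twist_ranks by simp
  also have "\<dots> \<le> free_rank A" by (rule twist_coset_growth(1)) simp
  finally show ?thesis .
qed

end

theorem theorem2:
  fixes G :: "('a, 'b) monoid_scheme" and S N :: "'a set" and \<phi> :: "'a \<Rightarrow> 'a"
  assumes "group G" and "finitely_generated G" and "virtually_abelian G"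
    and "finite S" and "S \<subseteq> carrier G" and "generate G S = carrier G"
    and "N \<lhd> G" and "comm_group (G\<lparr>carrier := N\<rparr>)" and "torsion_free (G\<lparr>carrier := N\<rparr>)"
    and "finite (rcosets\<^bsub>G\<^esub> N)"
    and "\<phi> \<in> hom G G" and "\<phi> ` N \<subseteq> N"
  shows "(\<lambda>r::real. real (twisted_growth G S \<phi> r)) \<in>
           \<Theta>(\<lambda>r. r powr (real (free_rank (G\<lparr>carrier := N\<rparr>)) - real (min_twisted_rank G N \<phi>)))
       \<and> (\<lambda>r::real. real (card (word_ball G S r))) \<in>
           \<Theta>(\<lambda>r. r ^ free_rank (G\<lparr>carrier := N\<rparr>))"
proof -
  interpret G: group G by (rule assms(1))
  interpret N: normal N G by (rule assms(7))
  interpret N_grp: comm_group "G\<lparr>carrier := N\<rparr>" by (rule assms(8))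
  interpret twisted_by_finite G S N \<phi>
    by unfold_locales (use assms in auto)
  have "\<forall>\<^sub>F r::real in at_top. r powr (real (free_rank A) - real (min_twisted_rank G N \<phi>))
      = r ^ (free_rank A - min_twisted_rank G N \<phi>)"
    using eventually_gt_at_top[of 0]
    by eventually_elim (simp add: min_twisted_rank_le powr_realpow flip: of_nat_diff)
  then have "\<Theta>(\<lambda>r::real. r powr (real (free_rank A) - real (min_twisted_rank G N \<phi>)))
      = \<Theta>(\<lambda>r. r ^ (free_rank A - min_twisted_rank G N \<phi>))"
    by (rule landau_theta.cong)
  then show ?thesis using twisted_growth_bigtheta word_ball_growth by simp
qed

end
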